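(* Let $\{p_\theta:\theta\in\mathbb{T}\}$ be an invariant statistical model satisfying the Model Assumptions (including A1--A3) given in the context, with $\mathbb{T}=\mathscr{G}=\overline{\mathscr{G}}$, and let $\mathsf{Q}_x$ be the fiducial distribution. Let $(\mathscr{K},\ast,\lesssim)$ be a group with a bi-invariant total order $\lesssim$, let $\psi:\mathscr{G}\to\mathscr{K}$ be a homomorphism, i.e., $\psi(g\circ g')=\psi(g)\ast\psi(g')$ for all $g,g'\in\mathscr{G}$, let $k\in\mathscr{K}$, and define $$A=A_{\psi,k}=\{\theta\in\mathbb{T}:\psi(\theta)\lesssim k\},$$ where $A$ is assumed measurable so that $\mathsf{Q}_x(A)$ is defined. Then $A$ is not afflicted with false confidence, i.e., $$\sup_{\theta\in A}\mathsf{P}_\theta\{\mathsf{Q}_X(A)\le\alpha\}\le\alpha\quad\text{for all }\alpha\in[0,1].$$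
   Context: Setting. $X\in\mathbb{X}$ is observable data with distribution $\mathsf{P}_\theta$, $\theta\in\mathbb{T}$. $\mathscr{G}$ is a locally compact topological group of bijections $g:\mathbb{X}\to\mathbb{X}$, with composition $\circ$; $gx$ denotes the image of $x$. Each $g\in\mathscr{G}$ induces a bijection $\bar g:\mathbb{T}\to\mathbb{T}$, and $\overline{\mathscr{G}}$ is the group of these. It is assumed that $\mathbb{T}=\mathscr{G}=\overline{\mathscr{G}}$, so parameter values $\theta$ are group elements and $\bar g\theta=g\circ\theta$. Each $\mathsf{P}_\theta$ has a density $p_\theta$ with respect to a common $\sigma$-finite measure, and the family is invariant: $p_\theta(x)=p_{\bar g\theta}(gx)\,\chi(g)$ for all $x\in\mathbb{X}$, $\theta\in\mathbb{T}$, $g\in\mathscr{G}$, where $\chi(g)$ is a multiplier (change-of-variables Jacobian). Moreover: A1. The left Haar measure $\lambda$ and corresponding right Haar measure $\rho$ on the Borel $\sigma$-algebra of $\mathscr{G}$ exist and are unique up to scalar multiples. A2. There is a bijection $t:\mathbb{X}\to\mathscr{G}\times\mathbb{U}$, with $t$ and $t^{-1}$ measurable, mapping $x$ to its position--orbit coordinates $(g_x,u_x)$, where $u_x$ labels the orbit $\mathscr{G}x=\{gx:g\in\mathscr{G}\}$ and $g_x$ is the position of $x$ on that orbit; thus $t(gx)=(g\circ g_x,u_x)$ for all $g\in\mathscr{G}$. A3. The distribution of $t(X)=(G,U)$ induced by $X\sim\mathsf{P}_\theta$ has a density with respect to $\lambda\times\mu$ for some measure $\mu$ on $\mathbb{U}$.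 Under these assumptions the joint density of $(G,U)$ under $\mathsf{P}_\theta$ has the form $p_\theta(g,u)=f(\theta^{-1}\circ g,u)$ for $(\lambda\times\mu)$-almost all $(g,u)$, for a fixed function $f:\mathscr{G}\times\mathbb{U}\to\mathbb{R}$ not depending on $\theta$. Put $H:=\theta^{-1}\circ G$. Its conditional distribution given $U=u$, when $X\sim\mathsf{P}_\theta$, does not depend on $\theta$; it has $\lambda$-density proportional to $h\mapsto f(h,u)$. Below, $\mathsf{P}(\cdot\mid U=u)$ refers to this conditional distribution. Fiducial distribution. For $x$ with $t(x)=(g,u)$, $\mathsf{Q}_x(A)=\mathsf{P}(g\circ H^{-1}\in A\mid U=u)$ for measurable $A\subseteq\mathbb{T}$. In $\mathsf{P}_\theta\{\mathsf{Q}_X(A)\le\alpha\}$ the random quantity is $X\sim\mathsf{P}_\theta$. Bi-invariance. A total order $\lesssim$ on a group $(\mathscr{K},\ast)$ is bi-invariant if $a\lesssim b$ implies $k\ast a\lesssim k\ast b$ and $a\ast k\lesssim b\ast k$ for all $a,b,k\in\mathscr{K}$. *)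

theory Defs
  imports
    "HOL-Probability.Probability"
    "HOL-Algebra.Coset"
    "HOL-Algebra.Bij"
begin

section \<open>Topological groups and Haar measures\<close>

locale topological_group = group G for G :: "('g, 'b) monoid_scheme" (structure) +
  fixes T :: "'g topology"
  assumes topspace_eq: "topspace T = carrier G"
    and continuous_mult: "continuous_map (prod_topology T T) T (\<lambda>(g, h). g \<otimes> h)"
    and continuous_inv: "continuous_map T T (\<lambda>g. inv g)"

definition borel_of :: "'g topology \<Rightarrow> 'g measure" where
  "borel_of T = sigma (topspace T) {U. openin T U}"

definition radon_measure :: "'g topology \<Rightarrow> 'g measure \<Rightarrow> bool" where
  "radon_measure T M \<longleftrightarrow>
     sets M = sets (borel_of T) \<and>
     (\<forall>C. compactin T C \<longrightarrow> emeasure M C < \<infinity>) \<and>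
     (\<forall>B\<in>sets M. emeasure M B = (INF U\<in>{U. openin T U \<and> B \<subseteq> U}. emeasure M U)) \<and>
     (\<forall>U. openin T U \<longrightarrow> emeasure M U = (SUP C\<in>{C. compactin T C \<and> C \<subseteq> U}. emeasure M C))"

definition left_haar_measure :: "('g, 'b) monoid_scheme \<Rightarrow> 'g topology \<Rightarrow> 'g measure \<Rightarrow> bool" where
  "left_haar_measure G T M \<longleftrightarrow>
     radon_measure T M \<and> emeasure M (carrier G) \<noteq> 0 \<and>
     (\<forall>g\<in>carrier G. \<forall>B\<in>sets M. emeasure M (g <#\<^bsub>G\<^esub> B) = emeasure M B)"

definition right_haar_measure :: "('g, 'b) monoid_scheme \<Rightarrow> 'g topology \<Rightarrow> 'g measure \<Rightarrow> bool" where
  "right_haar_measure G T M \<longleftrightarrow>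
     radon_measure T M \<and> emeasure M (carrier G) \<noteq> 0 \<and>
     (\<forall>g\<in>carrier G. \<forall>B\<in>sets M. emeasure M (B #>\<^bsub>G\<^esub> g) = emeasure M B)"


section \<open>Invariant statistical models\<close>

definition model_dist :: "'x measure \<Rightarrow> ('th \<Rightarrow> 'x \<Rightarrow> real) \<Rightarrow> 'th \<Rightarrow> 'x measure" where
  "model_dist \<nu> p \<theta> = density \<nu> (\<lambda>x. ennreal (p \<theta> x))"

text \<open>
  The sample space is \<open>space \<nu>\<close>, with \<open>\<nu>\<close> the dominating measure. The elements of \<open>G\<close> are themselves
  bijections of the sample space, so \<open>g x\<close> is the action. Parameters are elements of \<open>carrier G\<close>,
  and the bijection of the parameter space induced by \<open>g\<close> is \<open>\<theta> \<mapsto> g \<otimes> \<theta>\<close>.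

  The measure \<open>\<mu>\<close> lives on the space of orbit labels \<open>space \<mu>\<close>, and \<open>t x\<close> is the pair of position and
  orbit label of \<open>x\<close>. That two points have the same label exactly when they lie on the same orbit
  follows from \<open>t_bij\<close> and \<open>t_equivariant\<close>.
\<close>

locale invariant_model = topological_group G T
  for G :: "('x \<Rightarrow> 'x) monoid" (structure) and T +
  fixes \<nu> :: "'x measure"
    and p :: "('x \<Rightarrow> 'x) \<Rightarrow> 'x \<Rightarrow> real"
    and mlt :: "('x \<Rightarrow> 'x) \<Rightarrow> real"
    and lam \<rho> :: "('x \<Rightarrow> 'x) measure"
    and \<mu> :: "'u measure"
    and t :: "'x \<Rightarrow> ('x \<Rightarrow> 'x) \<times> 'u"
  assumes bijection_group:
      "subgroup (carrier G) (BijGroup (space \<nu>))"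
      "G = (BijGroup (space \<nu>))\<lparr>carrier := carrier G\<rparr>"
    and locally_compact: "locally_compact_space T" "Hausdorff_space T"
    and dominating: "sigma_finite_measure \<nu>"
    and densities:
      "\<And>\<theta>. \<theta> \<in> carrier G \<Longrightarrow> p \<theta> \<in> borel_measurable \<nu>"
      "\<And>\<theta> x. \<lbrakk>\<theta> \<in> carrier G; x \<in> space \<nu>\<rbrakk> \<Longrightarrow> 0 \<le> p \<theta> x"
      "\<And>\<theta>. \<theta> \<in> carrier G \<Longrightarrow> prob_space (model_dist \<nu> p \<theta>)"
    \<comment> \<open>\<open>mlt g\<close> is the Jacobian of \<open>g\<close> with respect to \<open>\<nu>\<close>, i.e. formally \<open>\<nu>(d(gx)) = mlt(g) \<nu>(dx)\<close>\<close>
    and multiplier: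
      "\<And>g. g \<in> carrier G \<Longrightarrow> 0 < mlt g"
      "\<And>g h. \<lbrakk>g \<in> carrier G; h \<in> carrier G\<rbrakk> \<Longrightarrow> mlt (g \<otimes> h) = mlt g * mlt h"
      "\<And>g B. \<lbrakk>g \<in> carrier G; B \<in> sets \<nu>\<rbrakk> \<Longrightarrow> emeasure \<nu> (g ` B) = ennreal (mlt g) * emeasure \<nu> B"
    and invariance:
      "\<And>x \<theta> g. \<lbrakk>x \<in> space \<nu>; \<theta> \<in> carrier G; g \<in> carrier G\<rbrakk>
         \<Longrightarrow> p \<theta> x = p (g \<otimes> \<theta>) (g x) * mlt g"
    and left_haar: "left_haar_measure G T lam"
    and left_haar_unique:
      "\<And>M. left_haar_measure G T M \<Longrightarrow> \<exists>c. 0 < c \<and> c < \<infinity> \<and> M = scale_measure c lam"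
    and right_haar: "right_haar_measure G T \<rho>"
    and right_haar_unique:
      "\<And>M. right_haar_measure G T M \<Longrightarrow> \<exists>c. 0 < c \<and> c < \<infinity> \<and> M = scale_measure c \<rho>"
    and right_haar_corresponds: "\<And>B. B \<in> sets lam \<Longrightarrow> emeasure \<rho> B = emeasure lam (set_inv B)"
    \<comment> \<open>needed for \<open>lam \<Otimes>\<^sub>M \<mu>\<close> to be the product measure\<close>
    and sigma_finite: "sigma_finite_measure lam" "sigma_finite_measure \<mu>"
    and t_bij: "bij_betw t (space \<nu>) (carrier G \<times> space \<mu>)"
    and t_measurable: "t \<in> measurable \<nu> (lam \<Otimes>\<^sub>M \<mu>)"
    and t_inverse_measurable: "the_inv_into (space \<nu>) t \<in> measurable (lam \<Otimes>\<^sub>M \<mu>) \<nu>"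
    and t_equivariant:
      "\<And>g x. \<lbrakk>g \<in> carrier G; x \<in> space \<nu>\<rbrakk> \<Longrightarrow> t (g x) = (g \<otimes> fst (t x), snd (t x))"
    and coordinate_density:
      "\<And>\<theta>. \<theta> \<in> carrier G \<Longrightarrow> \<exists>q\<in>borel_measurable (lam \<Otimes>\<^sub>M \<mu>).
         distr (model_dist \<nu> p \<theta>) (lam \<Otimes>\<^sub>M \<mu>) t = density (lam \<Otimes>\<^sub>M \<mu>) q"


section \<open>The fiducial distribution\<close>

text \<open>
  \<open>f\<close> is a version of the joint density of \<open>(G, U) = t X\<close> under the neutral parameter value. By
  invariance, \<open>(g, u) \<mapsto> f (\<theta>\<inverse> \<circ> g, u)\<close> is then a joint density under \<open>P\<^sub>\<theta>\<close> for every \<open>\<theta>\<close>; conversely,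
  this property for all \<open>\<theta>\<close> determines \<open>f\<close> almost everywhere by its instance at the neutral element.
\<close>

definition pivotal_density ::
  "('x \<Rightarrow> 'x) monoid \<Rightarrow> 'x measure \<Rightarrow> (('x \<Rightarrow> 'x) \<Rightarrow> 'x \<Rightarrow> real) \<Rightarrow> ('x \<Rightarrow> 'x) measure \<Rightarrow>
    'u measure \<Rightarrow> ('x \<Rightarrow> ('x \<Rightarrow> 'x) \<times> 'u) \<Rightarrow> (('x \<Rightarrow> 'x) \<times> 'u \<Rightarrow> real) \<Rightarrow> bool" where
  "pivotal_density G \<nu> p lam \<mu> t f \<longleftrightarrow>
     f \<in> borel_measurable (lam \<Otimes>\<^sub>M \<mu>) \<and>
     (\<forall>z\<in>space (lam \<Otimes>\<^sub>M \<mu>). 0 \<le> f z) \<and>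
     distr (model_dist \<nu> p \<one>\<^bsub>G\<^esub>) (lam \<Otimes>\<^sub>M \<mu>) t = density (lam \<Otimes>\<^sub>M \<mu>) (\<lambda>z. ennreal (f z))"

text \<open>
  \<open>\<kappa> u\<close> is the conditional distribution of \<open>H = \<theta>\<inverse> \<circ> G\<close> given \<open>U = u\<close>: a Markov kernel that is a
  version of the regular conditional distribution under every \<open>P\<^sub>\<theta>\<close>, and whose value at almost
  every \<open>u\<close> has \<open>lam\<close>-density proportional to \<open>h \<mapsto> f (h, u)\<close>. The density condition matters when the
  Borel sets of \<open>G\<close> are not countably generated, as conditional distributions are then only unique
  almost surely for each fixed event.
\<close>

definition pivot_cond_dist ::
  "('x \<Rightarrow> 'x) monoid \<Rightarrow> 'x measure \<Rightarrow> (('x \<Rightarrow> 'x) \<Rightarrow> 'x \<Rightarrow> real) \<Rightarrow> ('x \<Rightarrow> 'x) measure \<Rightarrow>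
    'u measure \<Rightarrow> ('x \<Rightarrow> ('x \<Rightarrow> 'x) \<times> 'u) \<Rightarrow> (('x \<Rightarrow> 'x) \<times> 'u \<Rightarrow> real) \<Rightarrow>
    ('u \<Rightarrow> ('x \<Rightarrow> 'x) measure) \<Rightarrow> bool" where
  "pivot_cond_dist G \<nu> p lam \<mu> t f \<kappa> \<longleftrightarrow>
     \<kappa> \<in> measurable \<mu> (prob_algebra lam) \<and>
     (\<forall>\<theta>\<in>carrier G.
        let P = model_dist \<nu> p \<theta>; PU = distr P \<mu> (\<lambda>x. snd (t x))
        in (\<forall>B\<in>sets lam. \<forall>D\<in>sets \<mu>.
              emeasure P {x\<in>space \<nu>. inv\<^bsub>G\<^esub> \<theta> \<otimes>\<^bsub>G\<^esub> fst (t x) \<in> B \<and> snd (t x) \<in> D} =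
                (\<integral>\<^sup>+u\<in>D. emeasure (\<kappa> u) B \<partial>PU)) \<and>
           (AE u in PU. \<exists>c::real. \<kappa> u = density lam (\<lambda>h. ennreal c * ennreal (f (h, u)))))"

definition fiducial ::
  "('x \<Rightarrow> 'x) monoid \<Rightarrow> ('x \<Rightarrow> ('x \<Rightarrow> 'x) \<times> 'u) \<Rightarrow> ('u \<Rightarrow> ('x \<Rightarrow> 'x) measure) \<Rightarrow>
    'x \<Rightarrow> ('x \<Rightarrow> 'x) set \<Rightarrow> real" where
  "fiducial G t \<kappa> x A =
     (case t x of (g, u) \<Rightarrow> measure (\<kappa> u) {h\<in>carrier G. g \<otimes>\<^bsub>G\<^esub> inv\<^bsub>G\<^esub> h \<in> A})"


section \<open>Ordered groups and false confidence\<close>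

definition bi_invariant_total_order :: "('k, 'b) monoid_scheme \<Rightarrow> 'k rel \<Rightarrow> bool" where
  "bi_invariant_total_order K r \<longleftrightarrow>
     linear_order_on (carrier K) r \<and>
     (\<forall>a\<in>carrier K. \<forall>b\<in>carrier K. \<forall>k\<in>carrier K. (a, b) \<in> r \<longrightarrow>
        (k \<otimes>\<^bsub>K\<^esub> a, k \<otimes>\<^bsub>K\<^esub> b) \<in> r \<and> (a \<otimes>\<^bsub>K\<^esub> k, b \<otimes>\<^bsub>K\<^esub> k) \<in> r)"

text \<open>
  The supremum is taken in \<open>[0, \<infinity>]\<close>, so it is \<open>0\<close> for empty \<open>A\<close>. An arbitrary version of the
  conditional distribution may make \<open>{x. Q\<^sub>x(A) \<le> \<alpha>}\<close> non-measurable, though only up to a null set,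
  and \<^const>\<open>emeasure\<close> is \<open>0\<close> on non-measurable sets. The probability is therefore written as an outer
  measure, which agrees with \<^const>\<open>emeasure\<close> on measurable sets.
\<close>

definition no_false_confidence ::
  "('th \<Rightarrow> 'x measure) \<Rightarrow> ('x \<Rightarrow> 'th set \<Rightarrow> real) \<Rightarrow> 'th set \<Rightarrow> bool" where
  "no_false_confidence P Q A \<longleftrightarrow>
     (\<forall>\<alpha>\<in>{0..1}.
        (SUP \<theta>\<in>A. outer_measure_of (P \<theta>) {x\<in>space (P \<theta>). Q x A \<le> \<alpha>}) \<le> ennreal \<alpha>)"

end

theory Submission
  imports Defs
begin

text \<open>
  Fix \<open>\<theta> \<in> A\<close> and let \<open>H = \<theta>\<inverse> \<otimes> g\<close> be the pivot, where \<open>(g, U)\<close> are position and label of \<open>X\<close>. Unfolding the fiducial distribution gives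
  \<open>Q\<^sub>X(A) = \<kappa> U (B H)\<close> with \<open>B x = {h. \<psi> (\<theta> \<otimes> x \<otimes> h\<inverse>) \<lesssim> k}\<close>. Bi-invariance of the order makes \<open>B x\<close>
  smaller as \<open>\<psi> x\<close> grows, and \<open>\<psi> \<theta> \<lesssim> k\<close> puts \<open>x\<close> itself into \<open>B x\<close>. So the sets \<open>B x\<close> form a chain, and
  any two points satisfy \<open>y \<in> B x\<close> or \<open>x \<in> B y\<close>. Given \<open>U = u\<close> the pivot has
  distribution \<open>m = \<kappa> u\<close>, so the claim becomes \<open>m {x. m (B x) \<le> \<alpha>} \<le> \<alpha>\<close>, which says that a tail probability
  evaluated at its own random argument is stochastically no smaller than a uniform variable.
  This is \<open>emeasure_chain_sublevel_le\<close>, and \<open>emeasure_le_if_sections_le\<close> integrates it over \<open>u\<close>.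

  If tail probabilities were continuous this would be the classical argument about p-values. For
  an arbitrary ordered group no countable family of the \<open>B x\<close> need be cofinal. A countable subfamily
  whose measures approach the supremum still covers the event up to a remainder \<open>N\<close> such that
  \<open>B x \<inter> N\<close> is null for every \<open>x \<in> N\<close>. As \<open>y \<in> B x\<close> or \<open>x \<in> B y\<close> holds throughout \<open>N \<times> N\<close>, Fubini's
  theorem yields \<open>m(N)\<^sup>2 = 0\<close>.

  Fubini's theorem requires the relation \<open>y \<in> B x\<close>, which has the form \<open>y \<otimes> x\<inverse> \<in> E\<close>, to be measurable
  for the product of the Borel sigma-algebras. When the group is not second countable this can fail, because the product topology
  may then have open sets outside that product sigma-algebra. Regularity of Haar measure repairs this:
  \<open>E\<close> agrees up to a null set with a set \<open>D\<close> for which the relation \<open>y \<otimes> x\<inverse> \<in> D\<close> is product measurable on a conull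
  rectangle (\<open>joint_measurable_modification\<close>). Passing from \<open>E\<close> to \<open>D\<close> costs only null sets in
  each section, because translations and inversion preserve null sets of Haar measure
  (\<open>right_translate_null\<close>, \<open>inv_null\<close>), and \<open>\<kappa> u\<close> has a density with respect to Haar measure.
\<close>

section \<open>Borel sets and Radon measures\<close>

lemma sets_borel_of: "sets (borel_of T) = sigma_sets (topspace T) {U. openin T U}"
  unfolding borel_of_def by (rule sets_measure_of) (auto dest: openin_subset)

lemma space_borel_of: "space (borel_of T) = topspace T"
  unfolding borel_of_def by (rule space_measure_of) (auto dest: openin_subset)

lemma borel_of_open: "openin T U \<Longrightarrow> U \<in> sets (borel_of T)"
  by (simp add: sets_borel_of)

lemma borel_of_closed: "closedin T C \<Longrightarrow> C \<in> sets (borel_of T)"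
proof -
  assume C: "closedin T C"
  then have "topspace T - (topspace T - C) \<in> sets (borel_of T)"
    by (metis borel_of_open closedin_def sets.compl_sets space_borel_of)
  then show ?thesis
    using closedin_subset[OF C] by (simp add: double_diff)
qed

lemma continuous_map_measurable_borel_of:
  assumes "continuous_map T S F"
  shows "F \<in> measurable (borel_of T) (borel_of S)"
proof -
  have "F \<in> measurable (borel_of T) (sigma (topspace S) {U. openin S U})"
  proof (rule measurable_measure_of)
    show "F \<in> space (borel_of T) \<rightarrow> topspace S"
      using assms by (auto simp: space_borel_of continuous_map_def)
    show "F -` U \<inter> space (borel_of T) \<in> sets (borel_of T)" if "U \<in> {U. openin S U}" for U
    proof -
      have "F -` U \<inter> space (borel_of T) = {x \<in> topspace T. F x \<in> U}"
        by (auto simp: space_borel_of)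
      then show ?thesis
        using assms that by (auto intro: borel_of_open simp: openin_continuous_map_preimage)
    qed
  qed (auto dest: openin_subset)
  then show ?thesis by (simp add: borel_of_def)
qed

locale sigma_finite_radon_space =
  fixes T :: "'a topology" and M :: "'a measure"
  assumes locally_compact_T: "locally_compact_space T"
    and Hausdorff_T: "Hausdorff_space T"
    and radon: "radon_measure T M"
    and sigma_finite_M: "sigma_finite_measure M"
begin

lemma sets_M: "sets M = sets (borel_of T)"
  using radon by (simp add: radon_measure_def)

lemma space_M: "space M = topspace T"
  using sets_eq_imp_space_eq[OF sets_M] by (simp add: space_borel_of)

lemma open_sets: "openin T U \<Longrightarrow> U \<in> sets M"
  by (simp add: sets_M borel_of_open)

lemma closed_sets: "closedin T C \<Longrightarrow> C \<in> sets M"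
  by (simp add: sets_M borel_of_closed)

lemma compact_sets: "compactin T C \<Longrightarrow> C \<in> sets M"
  using Hausdorff_T closed_sets compactin_imp_closedin by blast

lemma compact_finite: "compactin T C \<Longrightarrow> emeasure M C < \<infinity>"
  using radon by (simp add: radon_measure_def)

lemma open_superset_approx:
  assumes B: "B \<in> sets M" "emeasure M B < \<infinity>" and e: "0 < (e::real)"
  obtains U where "openin T U" "B \<subseteq> U" "emeasure M (U - B) \<le> ennreal e" "emeasure M U < \<infinity>"
proof -
  have "(INF U\<in>{U. openin T U \<and> B \<subseteq> U}. emeasure M U) = emeasure M B"
    using radon B by (simp add: radon_measure_def)
  also have "\<dots> < emeasure M B + ennreal e"
    using B e by (cases "emeasure M B") (auto simp: ennreal_plus[symmetric] ennreal_less_iff simp del: ennreal_plus)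
  finally obtain U where U: "openin T U" "B \<subseteq> U" "emeasure M U < emeasure M B + ennreal e"
    by (auto simp: INF_less_iff)
  have "emeasure M (U - B) = emeasure M U - emeasure M B"
    using B U by (intro emeasure_Diff) (auto intro: open_sets)
  also have "\<dots> \<le> ennreal e"
    using U(3) B(2) by (auto simp: ennreal_minus_le_iff order.strict_implies_order)
  finally have "emeasure M (U - B) \<le> ennreal e" .
  moreover have "emeasure M U < \<infinity>"
    using U(3) B(2) by (metis ennreal_add_less_top ennreal_less_top infinity_ennreal_def order.strict_trans)
  ultimately show ?thesis using U that by blast
qed

lemma compact_subset_approx_open:
  assumes U: "openin T U" "emeasure M U < \<infinity>" and e: "0 < (e::real)"
  obtains C where "compactin T C" "C \<subseteq> U" "emeasure M (U - C) \<le> ennreal e"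
proof (cases "emeasure M U = 0")
  case True
  show ?thesis by (rule that[of "{}"]) (use True in auto)
next
  case False
  have "emeasure M U - ennreal e < emeasure M U"
    using U e False by (cases "emeasure M U") (auto simp: ennreal_minus intro!: ennreal_lessI)
  also have "\<dots> = (SUP C\<in>{C. compactin T C \<and> C \<subseteq> U}. emeasure M C)"
    using radon U by (simp add: radon_measure_def)
  finally obtain C where C: "compactin T C" "C \<subseteq> U" "emeasure M U - ennreal e < emeasure M C"
    by (auto simp: less_SUP_iff)
  have "emeasure M (U - C) = emeasure M U - emeasure M C"
    using C U compact_finite[OF C(1)] by (intro emeasure_Diff) (auto intro: compact_sets open_sets)
  also have "\<dots> \<le> ennreal e"
    using order.strict_implies_order[OF C(3)] U(2) by (auto simp: ennreal_minus_le_iff add.commute)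
  finally show ?thesis using C that by blast
qed

text \<open>
  Radon measures are inner regular by compact sets only on open sets by definition. For a Borel set
  \<open>B\<close> of finite measure, take \<open>K\<close> compact inside an open \<open>U \<supseteq> B\<close> and remove from it an open set \<open>V\<close> that covers
  \<open>U - B\<close>; each of the three approximations loses at most \<open>e / 3\<close>.
\<close>

lemma compact_subset_approx:
  assumes B: "B \<in> sets M" "emeasure M B < \<infinity>" and e: "0 < (e::real)"
  obtains C where "compactin T C" "C \<subseteq> B" "emeasure M (B - C) \<le> ennreal e"
proof -
  have e3: "0 < e / 3" using e by simp
  obtain U where U: "openin T U" "B \<subseteq> U" "emeasure M (U - B) \<le> ennreal (e/3)" "emeasure M U < \<infinity>"
    using open_superset_approx[OF B e3] .
  obtain K where K: "compactin T K" "K \<subseteq> U" "emeasure M (U - K) \<le> ennreal (e/3)"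
    using compact_subset_approx_open[OF U(1,4) e3] .
  have UB: "U - B \<in> sets M" "emeasure M (U - B) < \<infinity>"
    using U B by (auto intro: open_sets simp: le_less_trans)
  obtain V where V: "openin T V" "U - B \<subseteq> V" "emeasure M (V - (U - B)) \<le> ennreal (e/3)"
    using open_superset_approx[OF UB e3] .
  have "compactin T (K \<inter> (topspace T - V))"
    using K V by (intro compact_Int_closedin) auto
  then have C: "compactin T (K - V)"
    using compactin_subset_topspace[OF K(1)] by (simp add: Int_Diff[symmetric] Int_absorb2)
  have "emeasure M (B - (K - V)) \<le> emeasure M ((U - K) \<union> ((U - B) \<union> (V - (U - B))))"
  proof (rule emeasure_mono)
    show "B - (K - V) \<subseteq> (U - K) \<union> ((U - B) \<union> (V - (U - B)))" using U(2) by blast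
    show "(U - K) \<union> ((U - B) \<union> (V - (U - B))) \<in> sets M"
      using open_sets[OF U(1)] compact_sets[OF K(1)] open_sets[OF V(1)] B(1)
      by (intro sets.Un sets.Diff)
  qed
  also have "\<dots> \<le> emeasure M (U - K) + (emeasure M (U - B) + emeasure M (V - (U - B)))"
    using open_sets[OF U(1)] compact_sets[OF K(1)] open_sets[OF V(1)] B(1)
    by (intro order.trans[OF emeasure_subadditive] add_mono order.refl emeasure_subadditive sets.Un sets.Diff)
  also have "\<dots> \<le> ennreal (e/3) + (ennreal (e/3) + ennreal (e/3))"
    using U K V by (intro add_mono) auto
  also have "\<dots> = ennreal e"
    using e by (simp add: ennreal_plus[symmetric] del: ennreal_plus)
  finally show ?thesis
    using C that[of "K - V"] U(2) V(2) K(2) by blast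
qed

lemma compact_exhaustion:
  assumes B: "B \<in> sets M"
  obtains \<C> where "countable \<C>" "\<forall>C\<in>\<C>. compactin T C \<and> C \<subseteq> B"
    "emeasure M (B - \<Union>\<C>) = 0"
proof -
  interpret sigma_finite_measure M by (rule sigma_finite_M)
  obtain A :: "nat \<Rightarrow> 'a set" where A: "range A \<subseteq> sets M" "(\<Union>i. A i) = space M" "\<And>i. emeasure M (A i) \<noteq> \<infinity>"
    using sigma_finite by metis
  have Am: "A i \<in> sets M" for i using A by auto
  have fin: "emeasure M (B \<inter> A i) < \<infinity>" for i
  proof -
    have "emeasure M (B \<inter> A i) \<le> emeasure M (A i)"
      using Am by (intro emeasure_mono) auto
    also have "\<dots> < \<infinity>" using A(3) by (simp add: top.not_eq_extremum)
    finally show ?thesis .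
  qed
  have "\<forall>i n. \<exists>C. compactin T C \<and> C \<subseteq> B \<inter> A i \<and> emeasure M (B \<inter> A i - C) \<le> ennreal (inverse (Suc n))"
  proof (intro allI)
    fix i n
    show "\<exists>C. compactin T C \<and> C \<subseteq> B \<inter> A i \<and> emeasure M (B \<inter> A i - C) \<le> ennreal (inverse (Suc n))"
      using compact_subset_approx[of "B \<inter> A i" "inverse (Suc n)"] B Am fin by (metis inverse_positive_iff_positive of_nat_0_less_iff sets.Int zero_less_Suc)
  qed
  then obtain C where C: "\<And>i n. compactin T (C i n)" "\<And>i n. C i n \<subseteq> B \<inter> A i"
      "\<And>i n. emeasure M (B \<inter> A i - C i n) \<le> ennreal (inverse (real (Suc n)))"
    by metis
  have Cm: "C i n \<in> sets M" for i n using C compact_sets by blast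
  have null: "emeasure M (B \<inter> A i - (\<Union>n. C i n)) = 0" for i
  proof -
    have "emeasure M (B \<inter> A i - (\<Union>n. C i n)) \<le> ennreal e" if "0 < e" for e :: real
    proof -
      obtain n where n: "inverse (real (Suc n)) < e"
        using reals_Archimedean[of e] \<open>0 < e\<close> by blast
      have "emeasure M (B \<inter> A i - (\<Union>n. C i n)) \<le> emeasure M (B \<inter> A i - C i n)"
        using B Am Cm by (intro emeasure_mono) auto
      also have "\<dots> \<le> ennreal e"
        using C(3)[of i n] n by (meson ennreal_leI less_imp_le order.trans)
      finally show ?thesis .
    qed
    then show ?thesis
      by (metis add_0 ennreal_le_epsilon le_zero_eq)
  qed
  show ?thesis
  proof (rule that[of "range (case_prod C)"])
    have "emeasure M (B - \<Union>(range (case_prod C))) \<le> emeasure M (\<Union>i. B \<inter> A i - (\<Union>n. C i n))"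
    proof (rule emeasure_mono)
      show "B - \<Union>(range (case_prod C)) \<subseteq> (\<Union>i. B \<inter> A i - (\<Union>n. C i n))"
        using sets.sets_into_space[OF B] A(2) by fastforce
    qed (use B Am Cm in auto)
    also have "\<dots> = 0"
      using null B Am Cm by (intro emeasure_UN_eq_0) auto
    finally show "emeasure M (B - \<Union>(range (case_prod C))) = 0" by simp
    show "\<forall>D\<in>range (case_prod C). compactin T D \<and> D \<subseteq> B"
      using C(1,2) by fastforce
  qed auto
qed

end

section \<open>Joint measurability modulo null sets\<close>

context sigma_finite_radon_space
begin

text \<open>
  The intersection of the \<open>U n\<close> is a modification of \<open>C\<close> that is described by countably many open
  sets, each containing the closure of the next. The closures leave room for a product measurable set between the
  preimages of consecutive \<open>U n\<close> under a continuous map of two variables.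
\<close>

lemma compact_nested_neighbourhoods:
  assumes C: "compactin T C"
  obtains U :: "nat \<Rightarrow> 'a set" where "\<And>n. openin T (U n)" "\<And>n. C \<subseteq> U n"
    "\<And>n. T closure_of (U (Suc n)) \<subseteq> U n" "emeasure M ((\<Inter>n. U n) - C) = 0"
proof -
  have Cm: "C \<in> sets M" "emeasure M C < \<infinity>"
    using C by (rule compact_sets, rule compact_finite)
  have reg: "regular_space T"
    using locally_compact_T Hausdorff_T locally_compact_Hausdorff_imp_regular_space by blast
  define P where "P n V \<longleftrightarrow> openin T V \<and> C \<subseteq> V \<and> emeasure M (V - C) \<le> ennreal (inverse (Suc n))"
    for n :: nat and V
  have step: "\<exists>V. P n V \<and> T closure_of V \<subseteq> W" if W: "openin T W" "C \<subseteq> W" for n W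
  proof -
    obtain V where V: "openin T V" "C \<subseteq> V" "emeasure M (V - C) \<le> ennreal (inverse (Suc n))"
      using open_superset_approx[OF Cm, of "inverse (Suc n)"] by auto
    have cl: "closedin T (topspace T - W)" "disjnt C (topspace T - W)"
      using W by (auto simp: disjnt_iff)
    then obtain A B where AB: "openin T A" "openin T B" "C \<subseteq> A" "topspace T - W \<subseteq> B" "disjnt A B"
      using reg[unfolded regular_space_compact_closed_sets, rule_format, of C "topspace T - W"] C
      by blast
    have "T closure_of (V \<inter> A) \<subseteq> topspace T - B"
      using AB V(1) by (intro closure_of_minimal) (auto simp: disjnt_iff dest: openin_subset)
    also have "\<dots> \<subseteq> W" using AB(4) by blast
    finally have "T closure_of (V \<inter> A) \<subseteq> W" .
    moreover have "emeasure M (V \<inter> A - C) \<le> emeasure M (V - C)"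
      using V Cm by (intro emeasure_mono) (auto intro: open_sets)
    ultimately show ?thesis
      using V AB by (intro exI[of _ "V \<inter> A"]) (auto simp: P_def)
  qed
  have "\<exists>U. \<forall>n. P n (U n) \<and> T closure_of (U (Suc n)) \<subseteq> U n"
  proof (rule dependent_nat_choice)
    show "\<exists>V. P 0 V"
      using step[of "topspace T" 0] compactin_subset_topspace[OF C] by auto
    show "\<exists>V. P (Suc n) V \<and> T closure_of V \<subseteq> W" if "P n W" for W n
      using step[of W "Suc n"] that by (auto simp: P_def)
  qed
  then obtain U where U: "\<And>n. P n (U n)" "\<And>n. T closure_of (U (Suc n)) \<subseteq> U n" by blast
  have Um: "U n \<in> sets M" for n using U(1)[of n] open_sets by (simp add: P_def)
  have "emeasure M ((\<Inter>n. U n) - C) \<le> ennreal e" if "0 < e" for e :: real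
  proof -
    obtain n where n: "inverse (real (Suc n)) < e"
      using reals_Archimedean[of e] \<open>0 < e\<close> by blast
    have "emeasure M ((\<Inter>n. U n) - C) \<le> emeasure M (U n - C)"
      using Um Cm by (intro emeasure_mono) auto
    also have "\<dots> \<le> ennreal (inverse (real (Suc n)))" using U(1)[of n] by (simp add: P_def)
    also have "\<dots> \<le> ennreal e" using n by (intro ennreal_leI) simp
    finally show ?thesis .
  qed
  then have "emeasure M ((\<Inter>n. U n) - C) = 0"
    by (metis add_0 ennreal_le_epsilon le_zero_eq)
  then show ?thesis using that[of U] U by (simp add: P_def)
qed

text \<open>
  A general open subset of \<open>T \<times> T\<close> is an uncountable union of rectangles, hence possibly not product
  measurable; compactness provides a finite union that separates \<open>S\<close> from the complement of \<open>W\<close>.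
\<close>

lemma rectangle_cover_compact:
  assumes S: "compactin (prod_topology T T) S" and W: "openin (prod_topology T T) W" "S \<subseteq> W"
  obtains D where "D \<in> sets (M \<Otimes>\<^sub>M M)" "S \<subseteq> D" "D \<subseteq> W"
proof -
  define \<U> where "\<U> = {A \<times> B |A B. openin T A \<and> openin T B \<and> A \<times> B \<subseteq> W}"
  have "\<And>R. R \<in> \<U> \<Longrightarrow> openin (prod_topology T T) R"
    by (auto simp: \<U>_def openin_prod_Times_iff)
  moreover have "S \<subseteq> \<Union>\<U>"
  proof
    fix z assume "z \<in> S"
    then have "z \<in> W" using W by blast
    then obtain A B where "openin T A" "openin T B" "fst z \<in> A" "snd z \<in> B" "A \<times> B \<subseteq> W"
      using W(1) unfolding openin_prod_topology_alt by (metis prod.collapse)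
    then show "z \<in> \<Union>\<U>"
      unfolding \<U>_def by (cases z) (auto intro!: exI[of _ "A \<times> B"])
  qed
  ultimately obtain \<F> where F: "finite \<F>" "\<F> \<subseteq> \<U>" "S \<subseteq> \<Union>\<F>"
    using S unfolding compactin_def by meson
  have "\<Union>\<F> \<in> sets (M \<Otimes>\<^sub>M M)"
  proof (rule sets.finite_Union[OF F(1)])
    show "\<F> \<subseteq> sets (M \<Otimes>\<^sub>M M)"
      using F(2) by (auto simp: \<U>_def intro!: pair_measureI open_sets)
  qed
  moreover have "\<Union>\<F> \<subseteq> W" using F(2) by (auto simp: \<U>_def)
  ultimately show ?thesis using F(3) that by blast
qed

text \<open>
  Take \<open>D\<close> to be the intersection of shrinking neighbourhoods \<open>U n\<close> of \<open>C\<close>. On a compact rectangle, the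
  preimages of the closure of \<open>U (n + 1)\<close> and of \<open>U n\<close> are compact and open, so a finite union of
  rectangles fits between them, and the intersection over \<open>n\<close> of these unions is the preimage of \<open>D\<close>.
\<close>

lemma joint_measurable_hull_compact:
  assumes F: "continuous_map (prod_topology T T) T F" and C: "compactin T C"
    and \<K>: "countable \<K>" "\<forall>K\<in>\<K>. compactin T K"
  shows "\<exists>D. D \<in> sets M \<and> C \<subseteq> D \<and> emeasure M (D - C) = 0 \<and>
    {z \<in> \<Union>\<K> \<times> \<Union>\<K>. F z \<in> D} \<in> sets (M \<Otimes>\<^sub>M M)"
proof -
  obtain U :: "nat \<Rightarrow> 'a set" where U: "\<And>n. openin T (U n)" "\<And>n. C \<subseteq> U n"
    "\<And>n. T closure_of (U (Suc n)) \<subseteq> U n" "emeasure M ((\<Inter>n. U n) - C) = 0"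
    using compact_nested_neighbourhoods[OF C] by metis
  have rect: "{z \<in> K \<times> L. F z \<in> (\<Inter>n. U n)} \<in> sets (M \<Otimes>\<^sub>M M)" if KL: "compactin T K" "compactin T L" for K L
  proof -
    have KLsub: "K \<times> L \<subseteq> topspace (prod_topology T T)"
      using KL compactin_subset_topspace by fastforce
    have "\<forall>n. \<exists>D. D \<in> sets (M \<Otimes>\<^sub>M M) \<and> {z \<in> K \<times> L. F z \<in> T closure_of (U (Suc n))} \<subseteq> D
        \<and> D \<subseteq> {z \<in> topspace (prod_topology T T). F z \<in> U n}"
    proof
      fix n
      let ?S = "{z \<in> K \<times> L. F z \<in> T closure_of (U (Suc n))}"
      let ?W = "{z \<in> topspace (prod_topology T T). F z \<in> U n}"
      have eq: "(K \<times> L) \<inter> {z \<in> topspace (prod_topology T T). F z \<in> T closure_of (U (Suc n))} = ?S"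
        using KLsub by blast
      have cl: "closedin (prod_topology T T)
          {z \<in> topspace (prod_topology T T). F z \<in> T closure_of (U (Suc n))}"
        using F by (rule closedin_continuous_map_preimage) simp
      have "compactin (prod_topology T T) (K \<times> L)"
        using KL by (simp add: compactin_Times)
      from compact_Int_closedin[OF this cl] have S: "compactin (prod_topology T T) ?S"
        by (simp only: eq)
      have W: "openin (prod_topology T T) ?W"
        using F U(1) by (rule openin_continuous_map_preimage)
      have SW: "?S \<subseteq> ?W"
        using KLsub U(3)[of n] by blast
      obtain D where "D \<in> sets (M \<Otimes>\<^sub>M M)" "?S \<subseteq> D" "D \<subseteq> ?W"
        using rectangle_cover_compact[OF S W SW] .
      then show "\<exists>D. D \<in> sets (M \<Otimes>\<^sub>M M) \<and> ?S \<subseteq> D \<and> D \<subseteq> ?W" by (intro exI[of _ D] conjI)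
    qed
    from choice[OF this] obtain D where D': "\<forall>n. D n \<in> sets (M \<Otimes>\<^sub>M M) \<and>
        {z \<in> K \<times> L. F z \<in> T closure_of (U (Suc n))} \<subseteq> D n \<and>
        D n \<subseteq> {z \<in> topspace (prod_topology T T). F z \<in> U n}"
      by (rule exE)
    have D: "D n \<in> sets (M \<Otimes>\<^sub>M M)" "{z \<in> K \<times> L. F z \<in> T closure_of (U (Suc n))} \<subseteq> D n"
        "D n \<subseteq> {z \<in> topspace (prod_topology T T). F z \<in> U n}" for n
      using D'[rule_format, of n] by simp_all
    have cl: "U n \<subseteq> T closure_of (U n)" for n
      by (intro closure_of_subset openin_subset U)
    have "{z \<in> K \<times> L. F z \<in> (\<Inter>n. U n)} = (K \<times> L) \<inter> (\<Inter>n. D n)"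
    proof (intro equalityI subsetI)
      fix z assume z: "z \<in> {z \<in> K \<times> L. F z \<in> (\<Inter>n. U n)}"
      have "z \<in> D n" for n
        using D(2)[of n] z cl[of "Suc n"] by blast
      then show "z \<in> (K \<times> L) \<inter> (\<Inter>n. D n)" using z by blast
    next
      fix z assume "z \<in> (K \<times> L) \<inter> (\<Inter>n. D n)"
      then show "z \<in> {z \<in> K \<times> L. F z \<in> (\<Inter>n. U n)}" using D(3) by blast
    qed
    also have "\<dots> \<in> sets (M \<Otimes>\<^sub>M M)"
      using D(1) KL by (intro sets.Int pair_measureI compact_sets sets.countable_INT) auto
    finally show ?thesis .
  qed
  have "{z \<in> \<Union>\<K> \<times> \<Union>\<K>. F z \<in> (\<Inter>n. U n)}
      = (\<Union>K\<in>\<K>. \<Union>L\<in>\<K>. {z \<in> K \<times> L. F z \<in> (\<Inter>n. U n)})"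
    by blast
  also have "\<dots> \<in> sets (M \<Otimes>\<^sub>M M)"
    using \<K>(2) by (intro sets.countable_UN' image_subsetI \<K>(1) rect) auto
  finally have "{z \<in> \<Union>\<K> \<times> \<Union>\<K>. F z \<in> (\<Inter>n. U n)} \<in> sets (M \<Otimes>\<^sub>M M)" .
  moreover have "(\<Inter>n. U n) \<in> sets M"
    using U(1) open_sets by (intro sets.countable_INT) auto
  ultimately show ?thesis
    using U(2,4) by (intro exI[of _ "\<Inter>n. U n"]) auto
qed

text \<open>
  Borel sets are countable unions of compact sets up to a null set, so the previous lemma carries
  over. The inclusion \<open>E \<subseteq> D\<close> is lost, and both differences are merely null.
\<close>

lemma joint_measurable_modification:
  assumes F: "continuous_map (prod_topology T T) T F" and E: "E \<in> sets M"
    and \<K>: "countable \<K>" "\<forall>K\<in>\<K>. compactin T K"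
  obtains D where "D \<in> sets M" "emeasure M (E - D) = 0" "emeasure M (D - E) = 0"
    "{z \<in> \<Union>\<K> \<times> \<Union>\<K>. F z \<in> D} \<in> sets (M \<Otimes>\<^sub>M M)"
proof -
  obtain \<C> where C': "countable \<C>" "\<forall>C\<in>\<C>. compactin T C \<and> C \<subseteq> E" "emeasure M (E - \<Union>\<C>) = 0"
    using compact_exhaustion[OF E] .
  then have C: "countable \<C>" "\<And>C. C \<in> \<C> \<Longrightarrow> compactin T C" "\<And>C. C \<in> \<C> \<Longrightarrow> C \<subseteq> E"
    "emeasure M (E - \<Union>\<C>) = 0"
    by auto
  have "\<forall>C\<in>\<C>. \<exists>D. D \<in> sets M \<and> C \<subseteq> D \<and> emeasure M (D - C) = 0 \<and>
    {z \<in> \<Union>\<K> \<times> \<Union>\<K>. F z \<in> D} \<in> sets (M \<Otimes>\<^sub>M M)"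
    using joint_measurable_hull_compact[OF F C(2) \<K>] by (intro ballI)
  from bchoice[OF this] obtain D where D': "\<forall>C\<in>\<C>. D C \<in> sets M \<and> C \<subseteq> D C \<and> emeasure M (D C - C) = 0 \<and>
    {z \<in> \<Union>\<K> \<times> \<Union>\<K>. F z \<in> D C} \<in> sets (M \<Otimes>\<^sub>M M)"
    by (rule exE)
  have D: "D C \<in> sets M" "C \<subseteq> D C" "emeasure M (D C - C) = 0"
      "{z \<in> \<Union>\<K> \<times> \<Union>\<K>. F z \<in> D C} \<in> sets (M \<Otimes>\<^sub>M M)"
    if "C \<in> \<C>" for C
    using D'[rule_format, OF that] by simp_all
  let ?D = "\<Union>C\<in>\<C>. D C"
  have Cm: "C \<in> sets M" if "C \<in> \<C>" for C using C(2)[OF that] by (rule compact_sets)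
  have UCm: "\<Union>\<C> \<in> sets M" using C(1) Cm by (intro sets.countable_Union) auto
  have Dm: "?D \<in> sets M" using C(1) D(1) by (intro sets.countable_UN') auto
  show ?thesis
  proof (rule that[OF Dm])
    have "emeasure M (E - ?D) \<le> emeasure M (E - \<Union>\<C>)"
      using D(2) E UCm by (intro emeasure_mono) auto
    then show "emeasure M (E - ?D) = 0" using C(4) by simp
    have "(\<Union>C\<in>\<C>. D C - C) \<in> null_sets M"
      using C(1) D(1,3) Cm by (intro null_sets_UN') (auto intro!: null_setsI)
    moreover have "?D - E \<subseteq> (\<Union>C\<in>\<C>. D C - C)"
      using C(3) by blast
    ultimately show "emeasure M (?D - E) = 0"
      using Dm E by (meson null_setsD1 null_sets_subset sets.Diff)
    have "{z \<in> \<Union>\<K> \<times> \<Union>\<K>. F z \<in> ?D} = (\<Union>C\<in>\<C>. {z \<in> \<Union>\<K> \<times> \<Union>\<K>. F z \<in> D C})"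
      by blast
    also have "\<dots> \<in> sets (M \<Otimes>\<^sub>M M)"
      by (intro sets.countable_UN' image_subsetI C(1) D(4))
    finally show "{z \<in> \<Union>\<K> \<times> \<Union>\<K>. F z \<in> ?D} \<in> sets (M \<Otimes>\<^sub>M M)" .
  qed
qed

end

section \<open>Null sets of Haar measure\<close>

context topological_group
begin

lemma continuous_map_mult:
  "\<lbrakk>continuous_map S T a; continuous_map S T b\<rbrakk> \<Longrightarrow> continuous_map S T (\<lambda>z. a z \<otimes> b z)"
  using continuous_map_compose[OF continuous_map_pairedI continuous_mult, of S a b]
  by (simp add: comp_def)

lemma continuous_map_inv: "continuous_map S T a \<Longrightarrow> continuous_map S T (\<lambda>z. inv (a z))"
  using continuous_map_compose[OF _ continuous_inv, of S a] by (simp add: comp_def)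

lemma continuous_map_group_const: "x \<in> carrier G \<Longrightarrow> continuous_map S T (\<lambda>z. x)"
  by (simp add: topspace_eq)

end

locale sigma_finite_haar_group = topological_group G T + sigma_finite_radon_space T M
  for G :: "('g, 'b) monoid_scheme" (structure) and T M +
  assumes haar: "left_haar_measure G T M"
begin

lemma space_eq_carrier: "space M = carrier G"
  by (simp add: space_M topspace_eq)

lemma continuous_map_measurable:
  assumes "continuous_map T T \<phi>"
  shows "\<phi> \<in> measurable M M"
  using continuous_map_measurable_borel_of[OF assms] by (simp add: sets_M cong: measurable_cong_sets)

lemma preimage_sets:
  assumes "continuous_map T T \<phi>" "Z \<in> sets M"
  shows "{h \<in> carrier G. \<phi> h \<in> Z} \<in> sets M"
proof -
  have "\<phi> -` Z \<inter> space M \<in> sets M"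
    using continuous_map_measurable[OF assms(1)] assms(2) by (rule measurable_sets)
  moreover have "\<phi> -` Z \<inter> space M = {h \<in> carrier G. \<phi> h \<in> Z}"
    by (auto simp: space_eq_carrier)
  ultimately show ?thesis by simp
qed

lemma not_null: "emeasure M (carrier G) \<noteq> 0"
  using haar by (simp add: left_haar_measure_def)

lemma left_translate_null:
  assumes x: "x \<in> carrier G" and Z: "Z \<in> null_sets M"
  shows "{h \<in> carrier G. x \<otimes> h \<in> Z} \<in> null_sets M"
proof
  have Zs: "Z \<in> sets M" "Z \<subseteq> carrier G"
    using Z sets.sets_into_space[of Z M] by (auto simp: space_eq_carrier)
  show "{h \<in> carrier G. x \<otimes> h \<in> Z} \<in> sets M"
    using x Zs by (intro preimage_sets continuous_map_mult continuous_map_group_const) auto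
  have "{h \<in> carrier G. x \<otimes> h \<in> Z} = inv x <# Z"
  proof (intro equalityI subsetI)
    fix h assume "h \<in> {h \<in> carrier G. x \<otimes> h \<in> Z}"
    then have "h = inv x \<otimes> (x \<otimes> h)" "x \<otimes> h \<in> Z" using x by (auto simp: m_assoc[symmetric])
    then show "h \<in> inv x <# Z" unfolding l_coset_def by blast
  next
    fix h assume "h \<in> inv x <# Z"
    then obtain z where "z \<in> Z" "h = inv x \<otimes> z" unfolding l_coset_def by blast
    then show "h \<in> {h \<in> carrier G. x \<otimes> h \<in> Z}" using x Zs by (auto simp: m_assoc[symmetric])
  qed
  then show "emeasure M {h \<in> carrier G. x \<otimes> h \<in> Z} = 0"
    using haar x Zs Z by (simp add: left_haar_measure_def null_setsD1)
qed

text \<open>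
  Product measurability is only available on compact rectangles, so Fubini arguments are carried
  out on a conull countable union of compact sets.
\<close>

lemma conull_sigma_compact:
  obtains \<K> where "countable \<K>" "\<forall>K\<in>\<K>. compactin T K" "\<Union>\<K> \<in> sets M"
    "AE x in M. x \<in> \<Union>\<K>"
proof -
  obtain \<K> where K: "countable \<K>" "\<forall>K\<in>\<K>. compactin T K \<and> K \<subseteq> space M"
    "emeasure M (space M - \<Union>\<K>) = 0"
    using compact_exhaustion[OF sets.top] .
  have m: "\<Union>\<K> \<in> sets M" using K(1,2) by (intro sets.countable_Union) (auto intro: compact_sets)
  have "AE x in M. x \<in> \<Union>\<K>"
    using m K(3) by (intro AE_I[of _ _ "space M - \<Union>\<K>"]) auto
  then show ?thesis using that[OF K(1) _ m] K(2) by simp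
qed

text \<open>
  The usual Fubini argument: if \<open>D\<close> is null then so is each section \<open>{y. x\<inverse> \<otimes> y \<in> D} = x D\<close>, by left
  invariance; exchanging the integrals, some section \<open>{x. x\<inverse> \<otimes> y \<in> D} = y D\<inverse>\<close> is null, and left
  invariance again shows that \<open>D\<inverse>\<close> is null. Compactness allows \<open>D\<close> to be chosen as a
  null superset of \<open>C\<inverse>\<close> for which the relation is product measurable.
\<close>

lemma inv_compact_null:
  assumes C: "compactin T C" and null: "emeasure M ((\<lambda>h. inv h) ` C) = 0"
  shows "emeasure M C = 0"
proof -
  interpret sigma_finite_measure M by (rule sigma_finite_M)
  interpret MM: pair_sigma_finite M M ..
  have Csub: "C \<subseteq> carrier G" using compactin_subset_topspace[OF C] by (simp add: topspace_eq)
  let ?C = "(\<lambda>h. inv h) ` C"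
  have iC: "compactin T ?C" using C continuous_inv by (rule image_compactin)
  obtain \<K> where K: "countable \<K>" "\<forall>K\<in>\<K>. compactin T K" "\<Union>\<K> \<in> sets M" "AE x in M. x \<in> \<Union>\<K>"
    using conull_sigma_compact .
  define F where "F = (\<lambda>z. inv (fst z) \<otimes> snd z)"
  have F: "continuous_map (prod_topology T T) T F"
    unfolding F_def by (intro continuous_map_mult continuous_map_inv continuous_map_fst continuous_map_snd)
  from joint_measurable_hull_compact[OF F iC K(1,2)] obtain D
    where D: "D \<in> sets M" "?C \<subseteq> D" "emeasure M (D - ?C) = 0"
      and R: "{z \<in> \<Union>\<K> \<times> \<Union>\<K>. F z \<in> D} \<in> sets (M \<Otimes>\<^sub>M M)"
    by (elim exE conjE)
  have "D - ?C \<in> null_sets M" "?C \<in> null_sets M"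
    using D null compact_sets[OF iC] by (auto intro!: null_setsI)
  then have "(D - ?C) \<union> ?C \<in> null_sets M" by (rule null_sets.Un)
  then have Dnull: "D \<in> null_sets M" using D(2) by (simp add: Un_absorb2)
  define R where "R = {z \<in> \<Union>\<K> \<times> \<Union>\<K>. F z \<in> D}"
  have "AE x in M. AE y in M. (x, y) \<notin> R"
  proof (rule AE_I2)
    fix x assume "x \<in> space M"
    then have "{h \<in> carrier G. inv x \<otimes> h \<in> D} \<in> null_sets M"
      using Dnull by (intro left_translate_null) (auto simp: space_eq_carrier)
    then have "AE y in M. y \<notin> {h \<in> carrier G. inv x \<otimes> h \<in> D}" by (rule AE_not_in)
    then show "AE y in M. (x, y) \<notin> R"
      using AE_space by eventually_elim (auto simp: R_def F_def space_eq_carrier)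
  qed
  moreover have "{w \<in> space (M \<Otimes>\<^sub>M M). (fst w, snd w) \<notin> R} \<in> sets (M \<Otimes>\<^sub>M M)"
    using R unfolding R_def[symmetric] by simp
  ultimately have "AE y in M. AE x in M. (x, y) \<notin> R"
    by (simp add: MM.AE_commute[of "\<lambda>x y. (x, y) \<notin> R"])
  then have AE_ex: "AE y in M. y \<in> \<Union>\<K> \<and> y \<in> space M \<and> (AE x in M. (x, y) \<notin> R)"
    using K(4) AE_space by eventually_elim simp
  have not_False: "\<not> (AE y in M. False)"
    using not_null AE_iff_measurable[OF sets.top, of M "\<lambda>_. False"] by (simp add: space_eq_carrier)
  have "\<exists>y. y \<in> \<Union>\<K> \<and> y \<in> space M \<and> (AE x in M. (x, y) \<notin> R)"
  proof (rule ccontr)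
    assume none: "\<not> ?thesis"
    from AE_ex have "AE y in M. False" by eventually_elim (use none in blast)
    with not_False show False by contradiction
  qed
  then obtain y where y: "y \<in> \<Union>\<K>" "y \<in> carrier G" "AE x in M. (x, y) \<notin> R"
    by (auto simp: space_eq_carrier)
  have "AE x in M. inv y \<otimes> x \<notin> C"
    using y(3) K(4) AE_space
  proof eventually_elim
    case (elim x)
    then have x: "x \<in> carrier G" by (simp add: space_eq_carrier)
    show ?case
    proof
      assume "inv y \<otimes> x \<in> C"
      then have "inv (inv y \<otimes> x) \<in> D" using D(2) by blast
      then have "inv x \<otimes> y \<in> D" using x y(2) by (simp add: inv_mult_group)
      then have "(x, y) \<in> R"
        unfolding R_def F_def using elim(2) y(1) by (simp del: Union_iff)
      with elim(1) show False by contradiction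
    qed
  qed
  moreover have m: "{x \<in> carrier G. inv y \<otimes> x \<in> C} \<in> sets M"
    using compact_sets[OF C] y(2) by (intro preimage_sets continuous_map_mult continuous_map_group_const) auto
  ultimately have "{x \<in> carrier G. inv y \<otimes> x \<in> C} \<in> null_sets M"
    using AE_iff_null[of M "\<lambda>x. inv y \<otimes> x \<notin> C"] by (simp add: space_eq_carrier)
  then have "{h \<in> carrier G. y \<otimes> h \<in> {x \<in> carrier G. inv y \<otimes> x \<in> C}} \<in> null_sets M"
    by (rule left_translate_null[OF y(2)])
  also have "{h \<in> carrier G. y \<otimes> h \<in> {x \<in> carrier G. inv y \<otimes> x \<in> C}} = C"
    using y(2) Csub by (auto simp: m_assoc[symmetric])
  finally show ?thesis by (rule null_setsD1)
qed

text \<open>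
  By inner regularity it suffices that compact subsets of the inverse of \<open>Z\<close> are null. Exhausting \<open>Z\<close>
  itself would not do: it leaves a null remainder about whose inverse nothing is known yet.
\<close>

lemma inv_null:
  assumes Z: "Z \<in> null_sets M"
  shows "{h \<in> carrier G. inv h \<in> Z} \<in> null_sets M"
proof
  show m: "{h \<in> carrier G. inv h \<in> Z} \<in> sets M"
    using Z continuous_inv by (intro preimage_sets) auto
  obtain \<C> where C': "countable \<C>" "\<forall>C\<in>\<C>. compactin T C \<and> C \<subseteq> {h \<in> carrier G. inv h \<in> Z}"
      "emeasure M ({h \<in> carrier G. inv h \<in> Z} - \<Union>\<C>) = 0"
    using compact_exhaustion[OF m] .
  then have C: "countable \<C>" "\<And>C. C \<in> \<C> \<Longrightarrow> compactin T C"
      "\<And>C. C \<in> \<C> \<Longrightarrow> C \<subseteq> {h \<in> carrier G. inv h \<in> Z}"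
      "emeasure M ({h \<in> carrier G. inv h \<in> Z} - \<Union>\<C>) = 0"
    by auto
  have "C \<in> null_sets M" if "C \<in> \<C>" for C
  proof
    have "(\<lambda>h. inv h) ` C \<subseteq> Z" using C(3)[OF that] by blast
    moreover have "compactin T ((\<lambda>h. inv h) ` C)" using C(2)[OF that] continuous_inv by (rule image_compactin)
    ultimately have "emeasure M ((\<lambda>h. inv h) ` C) = 0"
      using Z by (meson compact_sets null_setsD1 null_sets_subset)
    with C(2)[OF that] show "emeasure M C = 0" by (rule inv_compact_null)
  qed (use C(2) that compact_sets in auto)
  then have U: "\<Union>\<C> \<in> null_sets M"
    using null_sets_UN'[OF C(1), of "\<lambda>C. C" M] by simp
  have "{h \<in> carrier G. inv h \<in> Z} - \<Union>\<C> \<in> null_sets M"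
    using C(4) m U by (intro null_setsI) auto
  then have N: "({h \<in> carrier G. inv h \<in> Z} - \<Union>\<C>) \<union> \<Union>\<C> \<in> null_sets M"
    using U by (rule null_sets.Un)
  then show "emeasure M {h \<in> carrier G. inv h \<in> Z} = 0"
    by (intro null_setsD1 null_sets_subset[OF N m]) blast
qed

lemma right_translate_null:
  assumes x: "x \<in> carrier G" and Z: "Z \<in> null_sets M"
  shows "{h \<in> carrier G. h \<otimes> x \<in> Z} \<in> null_sets M"
proof -
  have "{h \<in> carrier G. inv h \<in> {h \<in> carrier G. inv x \<otimes> h \<in> {h \<in> carrier G. inv h \<in> Z}}} \<in> null_sets M"
    by (rule inv_null[OF left_translate_null[OF inv_closed[OF x] inv_null[OF Z]]])
  also have "{h \<in> carrier G. inv h \<in> {h \<in> carrier G. inv x \<otimes> h \<in> {h \<in> carrier G. inv h \<in> Z}}}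
      = {h \<in> carrier G. h \<otimes> x \<in> Z}"
    using x by (auto simp: inv_mult_group)
  finally show ?thesis .
qed

text \<open>
  \<open>R\<close> is a product measurable substitute for the relation \<open>y \<otimes> x\<inverse> \<in> E\<close>. Its sections in \<open>y\<close> are compared
  with the original by right translation. The last clause concerns the sections in the other variable, where
  the exceptional set is a translate of an inverse; it is needed because a relation that agrees with
  another in almost every point of each \<open>x\<close>-section might still differ from it in all points of a \<open>y\<close>-section
  when it is not product measurable.
\<close>

lemma division_relation_modification:
  assumes E: "E \<in> sets M"
  obtains X R where "X \<in> sets M" "AE x in M. x \<in> X" "R \<in> sets (M \<Otimes>\<^sub>M M)"
    "\<forall>x\<in>X. AE y in M. (x, y) \<in> R \<longleftrightarrow> y \<otimes> inv x \<in> E"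
    "\<forall>x\<in>X. AE y in M. x \<otimes> inv y \<in> E \<longrightarrow> (y, x) \<in> R"
proof -
  obtain \<K> where K: "countable \<K>" "\<forall>K\<in>\<K>. compactin T K" "\<Union>\<K> \<in> sets M" "AE x in M. x \<in> \<Union>\<K>"
    using conull_sigma_compact .
  have Kc: "\<Union>\<K> \<subseteq> carrier G"
    using K(3) sets.sets_into_space by (metis space_eq_carrier)
  define F where "F = (\<lambda>z. snd z \<otimes> inv (fst z))"
  have F: "continuous_map (prod_topology T T) T F"
    unfolding F_def by (intro continuous_map_mult continuous_map_inv continuous_map_fst continuous_map_snd)
  obtain D where D: "D \<in> sets M" "emeasure M (E - D) = 0" "emeasure M (D - E) = 0"
    and R: "{z \<in> \<Union>\<K> \<times> \<Union>\<K>. F z \<in> D} \<in> sets (M \<Otimes>\<^sub>M M)"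
    using joint_measurable_modification[OF F E K(1,2)] .
  have null: "E - D \<in> null_sets M" "D - E \<in> null_sets M"
    using D E by (auto intro!: null_setsI)
  show ?thesis
  proof (rule that[OF K(3,4) R]; rule ballI)
    fix x assume x: "x \<in> \<Union>\<K>"
    then have xG: "x \<in> carrier G" using Kc by blast
    have "{h \<in> carrier G. h \<otimes> inv x \<in> (E - D) \<union> (D - E)} \<in> null_sets M"
      by (rule right_translate_null[OF inv_closed[OF xG] null_sets.Un[OF null]])
    then have "AE y in M. y \<notin> {h \<in> carrier G. h \<otimes> inv x \<in> (E - D) \<union> (D - E)}"
      by (rule AE_not_in)
    then show "AE y in M. (x, y) \<in> {z \<in> \<Union>\<K> \<times> \<Union>\<K>. F z \<in> D} \<longleftrightarrow> y \<otimes> inv x \<in> E"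
      using K(4) AE_space by eventually_elim (use x in \<open>auto simp: F_def space_eq_carrier\<close>)
  next
    fix x assume x: "x \<in> \<Union>\<K>"
    then have xG: "x \<in> carrier G" using Kc by blast
    have "{h \<in> carrier G. inv h \<in> {h \<in> carrier G. x \<otimes> h \<in> E - D}} \<in> null_sets M"
      by (rule inv_null[OF left_translate_null[OF xG null(1)]])
    then have "AE y in M. y \<notin> {h \<in> carrier G. inv h \<in> {h \<in> carrier G. x \<otimes> h \<in> E - D}}"
      by (rule AE_not_in)
    then show "AE y in M. x \<otimes> inv y \<in> E \<longrightarrow> (y, x) \<in> {z \<in> \<Union>\<K> \<times> \<Union>\<K>. F z \<in> D}"
      using K(4) AE_space by eventually_elim (use x in \<open>auto simp: F_def space_eq_carrier\<close>)
  qed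
qed

end

section \<open>Chains of events\<close>

text \<open>
  Finite unions of members of a chain are members of the chain, and countable unions are limits of
  finite ones.
\<close>

lemma emeasure_countable_chain_le:
  assumes B: "\<And>n::nat. B n \<in> sets M" "\<And>n. emeasure M (B n) \<le> s"
    and chain: "\<And>m n. B m \<subseteq> B n \<or> B n \<subseteq> B m"
  shows "emeasure M (\<Union>n. B n) \<le> s"
proof -
  have ex: "\<exists>m. (\<Union>i\<le>n. B i) = B m" for n
  proof (induction n)
    case 0
    then show ?case by auto
  next
    case (Suc n)
    then obtain m where "(\<Union>i\<le>n. B i) = B m" by blast
    then have "(\<Union>i\<le>Suc n. B i) = B m \<union> B (Suc n)"
      by (auto simp: atMost_Suc)
    then show ?case using chain[of m "Suc n"] by (auto simp: Un_absorb1 Un_absorb2)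
  qed
  have "emeasure M (\<Union>n. \<Union>i\<le>n. B i) = (SUP n. emeasure M (\<Union>i\<le>n. B i))"
  proof (rule SUP_emeasure_incseq[symmetric])
    show "range (\<lambda>n. \<Union>i\<le>n. B i) \<subseteq> sets M" using B by auto
    show "incseq (\<lambda>n. \<Union>i\<le>n. B i)" by (rule monoI) force
  qed
  also have "\<dots> \<le> s"
    using ex B(2) by (metis SUP_least)
  also have "(\<Union>n. \<Union>i\<le>n. B i) = (\<Union>n. B n)" by auto
  finally show ?thesis .
qed

text \<open>
  The sets \<open>B x\<close> play the role of upper tails beginning at or below \<open>x\<close>. The
  relation \<open>R\<close> is a product measurable version of \<open>y \<in> B x\<close>; it makes the sublevel set measurable and gives
  access to Fubini's theorem. On
  the remainder \<open>N\<close> of the sublevel set outside countably many \<open>B x\<close>, each \<open>B x\<close> with \<open>x \<in> N\<close> meets \<open>N\<close> in a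
  null set, and totality of \<open>R\<close> on \<open>N \<times> N\<close> then forces \<open>N\<close> to be null.
\<close>

lemma (in finite_measure) emeasure_chain_sublevel_le:
  fixes B :: "'a \<Rightarrow> 'a set"
  assumes R: "R \<in> sets (M \<Otimes>\<^sub>M M)" and X: "X \<in> sets M"
    and B: "\<And>x. x \<in> X \<Longrightarrow> B x \<in> sets M"
    and section_B: "\<And>x. x \<in> X \<Longrightarrow> AE y in M. (x, y) \<in> R \<longleftrightarrow> y \<in> B x"
    and total: "\<And>x. x \<in> X \<Longrightarrow> AE y in M. (x, y) \<in> R \<or> (y, x) \<in> R"
    and chain: "\<And>x y. \<lbrakk>x \<in> X; y \<in> X\<rbrakk> \<Longrightarrow> B x \<subseteq> B y \<or> B y \<subseteq> B x"
    and up: "\<And>x y. \<lbrakk>x \<in> X; y \<in> X; y \<notin> B x\<rbrakk> \<Longrightarrow> B x \<subseteq> B y"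
  shows "emeasure M {x \<in> X. emeasure M (B x) \<le> a} \<le> a"
proof -
  have XM: "x \<in> space M" if "x \<in> X" for x using X that sets.sets_into_space by blast
  have sec: "emeasure M (Pair x -` R) = emeasure M (B x)" if "x \<in> X" for x
  proof (rule emeasure_eq_AE)
    show "AE y in M. y \<in> Pair x -` R \<longleftrightarrow> y \<in> B x"
      using section_B[OF that] by simp
  qed (use R B that in \<open>auto intro: sets_Pair1\<close>)
  define Z where "Z = {x \<in> X. emeasure M (B x) \<le> a}"
  have "Z = {x \<in> space M. x \<in> X \<and> emeasure M (Pair x -` R) \<le> a}"
    using XM sec by (auto simp: Z_def)
  moreover have "(\<lambda>x. emeasure M (Pair x -` R)) \<in> borel_measurable M"
    using R by (rule measurable_emeasure_Pair)
  ultimately have Zm: "Z \<in> sets M"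
    using X by simp
  have ZX: "Z \<subseteq> X" by (auto simp: Z_def)
  show ?thesis
  proof (cases "Z = {}")
    case True
    then show ?thesis by (simp add: Z_def[symmetric])
  next
    case False
    \<comment> \<open>Take a countable subfamily of the chain whose measures approach their supremum \<open>s\<close> over \<open>Z\<close>.\<close>
    define s where "s = (SUP x\<in>Z. emeasure M (B x))"
    obtain g :: "nat \<Rightarrow> ennreal" where g: "range g \<subseteq> (\<lambda>x. emeasure M (B x)) ` Z" "s = (SUP n. g n)"
      unfolding s_def using ennreal_SUP_countable_SUP[OF False] by meson
    then have "\<forall>n. \<exists>x\<in>Z. g n = emeasure M (B x)" by blast
    then obtain x where x: "\<And>n. x n \<in> Z" "\<And>n. g n = emeasure M (B (x n))"
      by metis
    define U where "U = (\<Union>n. B (x n))"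
    have Um: "U \<in> sets M" unfolding U_def using x ZX B by blast
    have s_ge: "emeasure M (B y) \<le> s" if "y \<in> Z" for y
      unfolding s_def using that by (intro SUP_upper)
    have Us: "emeasure M U \<le> s"
      unfolding U_def
    proof (rule emeasure_countable_chain_le)
      show "B (x n) \<in> sets M" for n using x ZX B by blast
      show "emeasure M (B (x n)) \<le> s" for n using x s_ge by blast
      show "B (x m) \<subseteq> B (x n) \<or> B (x n) \<subseteq> B (x m)" for m n using x ZX chain by blast
    qed
    have sU: "s \<le> emeasure M U"
      unfolding g(2) x(2) using Um by (intro SUP_least emeasure_mono) (auto simp: U_def)
    have s_le: "s \<le> a"
      unfolding s_def by (intro SUP_least) (auto simp: Z_def)
    define N where "N = Z - U"
    have Nm: "N \<in> sets M" using Zm Um by (simp add: N_def)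
    have NX: "N \<subseteq> X" using ZX by (auto simp: N_def)
    \<comment> \<open>For \<open>y\<close> in the remainder \<open>N\<close>, \<open>B y\<close> contains \<open>U\<close> without having larger measure.\<close>
    have BN: "AE z in M. z \<in> B y \<longrightarrow> z \<notin> N" if y: "y \<in> N" for y
    proof -
      have yX: "y \<in> X" using y NX by blast
      have UB: "U \<subseteq> B y"
        using up[of "x _" y] x(1) ZX y yX by (force simp: U_def N_def)
      have "emeasure M (B y - U) = emeasure M (B y) - emeasure M U"
        using UB B[OF yX] Um by (intro emeasure_Diff) auto
      also have "\<dots> = 0"
        using order.trans[OF s_ge[of y] sU] y by (simp add: N_def diff_eq_0_iff_ennreal less_top[symmetric])
      finally have "B y - U \<in> null_sets M"
        using B[OF yX] Um by (intro null_setsI) auto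
      then have "AE z in M. z \<notin> B y - U" by (rule AE_not_in)
      then show ?thesis by eventually_elim (auto simp: N_def)
    qed
    interpret MM: pair_sigma_finite M M ..
    \<comment> \<open>Fubini transfers nullity of the sections of \<open>R\<close> inside \<open>N \<times> N\<close> to its converse.\<close>
    have notR: "AE y in M. AE z in M. y \<in> N \<and> z \<in> N \<longrightarrow> (y, z) \<notin> R"
    proof (rule AE_I2)
      fix y
      show "AE z in M. y \<in> N \<and> z \<in> N \<longrightarrow> (y, z) \<notin> R"
      proof (cases "y \<in> N")
        case True
        then have "AE z in M. (y, z) \<in> R \<longleftrightarrow> z \<in> B y" using section_B NX by blast
        with BN[OF True] show ?thesis by eventually_elim blast
      qed auto
    qed
    have "AE z in M. AE y in M. y \<in> N \<and> z \<in> N \<longrightarrow> (y, z) \<notin> R"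
    proof (subst MM.AE_commute[symmetric])
      show "{w \<in> space (M \<Otimes>\<^sub>M M). fst w \<in> N \<and> snd w \<in> N \<longrightarrow> (fst w, snd w) \<notin> R} \<in> sets (M \<Otimes>\<^sub>M M)"
        using Nm R by measurable
    qed (rule notR)
    then have "AE y in M. AE z in M. \<not> (y \<in> N \<and> z \<in> N)"
      using notR
    proof eventually_elim
      case (elim y)
      show ?case
      proof (cases "y \<in> N")
        case True
        then have "AE z in M. (y, z) \<in> R \<or> (z, y) \<in> R" using total NX by blast
        with elim show ?thesis by eventually_elim blast
      qed auto
    qed
    then have dich: "AE y in M. y \<in> N \<longrightarrow> (AE z in M. z \<notin> N)"
      by eventually_elim auto
    have "AE y in M. y \<notin> N"
    proof (cases "AE z in M. z \<notin> N")
      case False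
      with dich show ?thesis by auto
    qed
    then have "emeasure M N = 0" 
      using Nm by (simp add: AE_iff_null_sets null_setsD1)
    have "emeasure M Z \<le> emeasure M (U \<union> N)"
      using sets.Un[OF Um Nm] by (intro emeasure_mono) (auto simp: N_def)
    also have "\<dots> \<le> emeasure M U + emeasure M N"
      using Um Nm by (intro emeasure_subadditive)
    also have "\<dots> \<le> a"
      using Us s_le \<open>emeasure M N = 0\<close> by simp
    finally show ?thesis by (simp add: Z_def)
  qed
qed

section \<open>Disintegration\<close>

text \<open>
  The identity on rectangles determines \<open>M\<close> as the composition of the law \<open>PU\<close> of the second
  coordinate with the kernel \<open>\<kappa>\<close> of conditional laws of the first, so \<open>M Y\<close> is an average over \<open>u\<close> of the measures of sections of \<open>Y\<close>.
\<close>

lemma emeasure_le_if_sections_le: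
  assumes \<kappa>: "\<kappa> \<in> measurable N (prob_algebra L)"
    and PU: "prob_space PU" "sets PU = sets N"
    and M: "prob_space M" "sets M = sets (L \<Otimes>\<^sub>M N)"
    and rect: "\<And>B D. \<lbrakk>B \<in> sets L; D \<in> sets N\<rbrakk> \<Longrightarrow> emeasure M (B \<times> D) = (\<integral>\<^sup>+u\<in>D. emeasure (\<kappa> u) B \<partial>PU)"
    and Y: "Y \<in> sets (L \<Otimes>\<^sub>M N)"
    and le: "AE u in PU. emeasure (\<kappa> u) ((\<lambda>h. (h, u)) -` Y) \<le> a"
  shows "emeasure M Y \<le> a"
proof -
  interpret PU: prob_space PU by (rule PU)
  interpret M: prob_space M by (rule M)
  define q where "q u = distr (\<kappa> u) (L \<Otimes>\<^sub>M N) (\<lambda>h. (h, u))" for u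
  have \<kappa>s: "\<kappa> \<in> measurable PU (subprob_algebra L)"
    using measurable_prob_algebraD[OF \<kappa>] by (simp cong: measurable_cong_sets add: PU)
  have spU: "space PU = space N" using PU(2) by (rule sets_eq_imp_space_eq)
  have \<kappa>u: "prob_space (\<kappa> u)" "sets (\<kappa> u) = sets L" "space (\<kappa> u) = space L" if "u \<in> space N" for u
    using measurable_space[OF \<kappa> that] by (auto simp: space_prob_algebra dest: sets_eq_imp_space_eq)
  have q: "q \<in> measurable PU (subprob_algebra (L \<Otimes>\<^sub>M N))"
    unfolding q_def
  proof (rule measurable_distr2[where M = L])
    have "(\<lambda>z. (snd z, fst z)) \<in> measurable (N \<Otimes>\<^sub>M L) (L \<Otimes>\<^sub>M N)" by measurable
    then have "(\<lambda>(u, h). (h, u)) \<in> measurable (N \<Otimes>\<^sub>M L) (L \<Otimes>\<^sub>M N)"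
      by (simp add: case_prod_beta')
    then show "(\<lambda>(u, h). (h, u)) \<in> measurable (PU \<Otimes>\<^sub>M L) (L \<Otimes>\<^sub>M N)"
      by (simp cong: measurable_cong_sets sets_pair_measure_cong add: PU)
  qed (rule \<kappa>s)
  have eq_q: "emeasure (q u) Z = emeasure (\<kappa> u) ((\<lambda>h. (h, u)) -` Z)"
    if "u \<in> space N" "Z \<in> sets (L \<Otimes>\<^sub>M N)" for u Z
  proof -
    have "(\<lambda>h. (h, u)) \<in> measurable (\<kappa> u) (L \<Otimes>\<^sub>M N)"
      using that(1) by (simp cong: measurable_cong_sets add: \<kappa>u)
    then have "emeasure (q u) Z = emeasure (\<kappa> u) ((\<lambda>h. (h, u)) -` Z \<inter> space (\<kappa> u))"
      unfolding q_def using that(2) by (rule emeasure_distr)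
    moreover have "(\<lambda>h. (h, u)) -` Z \<inter> space (\<kappa> u) = (\<lambda>h. (h, u)) -` Z"
      using sets.sets_into_space[OF that(2)] that(1) by (auto simp: \<kappa>u space_pair_measure)
    ultimately show ?thesis by simp
  qed
  have bind: "emeasure (PU \<bind> q) Z = (\<integral>\<^sup>+u. emeasure (\<kappa> u) ((\<lambda>h. (h, u)) -` Z) \<partial>PU)"
    if "Z \<in> sets (L \<Otimes>\<^sub>M N)" for Z
    using that eq_q
    by (subst emeasure_bind[OF PU.not_empty q that]) (auto intro!: nn_integral_cong simp: spU)
  have "M = PU \<bind> q"
  proof (rule measure_eqI_generator_eq[OF Int_stable_pair_measure_generator pair_measure_closed,
        where A = "\<lambda>_::nat. space L \<times> space N"])
    show "sets M = sigma_sets (space L \<times> space N) {a \<times> b |a b. a \<in> sets L \<and> b \<in> sets N}"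
      by (simp add: M sets_pair_measure)
    show "sets (PU \<bind> q) = sigma_sets (space L \<times> space N) {a \<times> b |a b. a \<in> sets L \<and> b \<in> sets N}"
      using q PU.not_empty by (subst sets_bind[where N = "L \<Otimes>\<^sub>M N"]) (auto simp: sets_pair_measure dest: sets_kernel)
    show "emeasure M X = emeasure (PU \<bind> q) X" if X: "X \<in> {a \<times> b |a b. a \<in> sets L \<and> b \<in> sets N}" for X
    proof -
      obtain B D where X: "X = B \<times> D" and BD: "B \<in> sets L" "D \<in> sets N" using X by blast
      have "emeasure (PU \<bind> q) X = (\<integral>\<^sup>+u. emeasure (\<kappa> u) ((\<lambda>h. (h, u)) -` (B \<times> D)) \<partial>PU)"
        unfolding X using BD by (intro bind) simp
      also have "\<dots> = (\<integral>\<^sup>+u\<in>D. emeasure (\<kappa> u) B \<partial>PU)"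
        by (intro nn_integral_cong) (auto split: split_indicator intro: arg_cong2[of _ _ _ _ emeasure])
      finally show ?thesis using rect[OF BD] by (simp add: X)
    qed
    show "range (\<lambda>_::nat. space L \<times> space N) \<subseteq> {a \<times> b |a b. a \<in> sets L \<and> b \<in> sets N}"
      by auto
  qed auto
  then have "emeasure M Y = (\<integral>\<^sup>+u. emeasure (\<kappa> u) ((\<lambda>h. (h, u)) -` Y) \<partial>PU)"
    using bind[OF Y] by simp
  also have "\<dots> \<le> (\<integral>\<^sup>+u. a \<partial>PU)" using le by (rule nn_integral_mono_AE)
  also have "\<dots> = a" by (simp add: PU.emeasure_space_1)
  finally show ?thesis .
qed

lemma kernel_section_sublevel_measurable:
  assumes \<kappa>: "\<kappa> \<in> measurable N (prob_algebra M)" and X: "X \<in> sets M" and R: "R \<in> sets (M \<Otimes>\<^sub>M M)"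
  shows "{(h, u). h \<in> X \<and> u \<in> space N \<and> emeasure (\<kappa> u) (Pair h -` R) \<le> a} \<in> sets (M \<Otimes>\<^sub>M N)"
proof -
  have "(\<lambda>z. emeasure (\<kappa> (snd z)) (Pair (fst z) -` R)) \<in> borel_measurable (M \<Otimes>\<^sub>M N)"
  proof (rule emeasure_measurable_subprob_algebra2[where N = M])
    have "(\<lambda>w. (fst (fst w), snd w)) \<in> measurable ((M \<Otimes>\<^sub>M N) \<Otimes>\<^sub>M M) (M \<Otimes>\<^sub>M M)"
      by measurable
    then have "(\<lambda>w. (fst (fst w), snd w)) -` R \<inter> space ((M \<Otimes>\<^sub>M N) \<Otimes>\<^sub>M M) \<in> sets ((M \<Otimes>\<^sub>M N) \<Otimes>\<^sub>M M)"
      using R by (rule measurable_sets)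
    moreover have "(\<lambda>w. (fst (fst w), snd w)) -` R \<inter> space ((M \<Otimes>\<^sub>M N) \<Otimes>\<^sub>M M)
        = (SIGMA z:space (M \<Otimes>\<^sub>M N). Pair (fst z) -` R)"
      using sets.sets_into_space[OF R] by (auto simp: space_pair_measure)
    ultimately show "(SIGMA z:space (M \<Otimes>\<^sub>M N). Pair (fst z) -` R) \<in> sets ((M \<Otimes>\<^sub>M N) \<Otimes>\<^sub>M M)"
      by simp
    show "(\<lambda>z. \<kappa> (snd z)) \<in> measurable (M \<Otimes>\<^sub>M N) (subprob_algebra M)"
      using measurable_prob_algebraD[OF \<kappa>] by (rule measurable_compose[OF measurable_snd])
  qed
  then have "{z \<in> space (M \<Otimes>\<^sub>M N). fst z \<in> X \<and> emeasure (\<kappa> (snd z)) (Pair (fst z) -` R) \<le> a} \<in> sets (M \<Otimes>\<^sub>M N)"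
    using X by measurable
  moreover have "{z \<in> space (M \<Otimes>\<^sub>M N). fst z \<in> X \<and> emeasure (\<kappa> (snd z)) (Pair (fst z) -` R) \<le> a}
      = {(h, u). h \<in> X \<and> u \<in> space N \<and> emeasure (\<kappa> u) (Pair h -` R) \<le> a}"
    using sets.sets_into_space[OF X] by (auto simp: space_pair_measure)
  ultimately show ?thesis by simp
qed

section \<open>Sets cut out by an ordered homomorphism\<close>

text \<open>
  Both sides of bi-invariance are used: \<open>x\<close> is multiplied by \<open>a\<close> on the left and by \<open>b\<close> on the right. In
  the application \<open>a\<close> is the true parameter and \<open>b\<close> is the inverse of a pivot value.
\<close>

lemma ordered_hom_cut_mono:
  assumes G: "group G" and K: "group K" and r: "bi_invariant_total_order K r" and \<psi>: "\<psi> \<in> hom G K"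
    and k: "k \<in> carrier K"
    and carr: "a \<in> carrier G" "x \<in> carrier G" "y \<in> carrier G" "b \<in> carrier G"
    and le: "(\<psi> x, \<psi> y) \<in> r" and cut: "(\<psi> (a \<otimes>\<^bsub>G\<^esub> y \<otimes>\<^bsub>G\<^esub> b), k) \<in> r"
  shows "(\<psi> (a \<otimes>\<^bsub>G\<^esub> x \<otimes>\<^bsub>G\<^esub> b), k) \<in> r"
proof -
  interpret G: group G by (rule G)
  interpret K: group K by (rule K)
  have c: "\<psi> a \<in> carrier K" "\<psi> x \<in> carrier K" "\<psi> y \<in> carrier K" "\<psi> b \<in> carrier K"
    using \<psi> carr by (auto simp: hom_def)
  have m: "\<psi> (a \<otimes>\<^bsub>G\<^esub> z \<otimes>\<^bsub>G\<^esub> b) = \<psi> a \<otimes>\<^bsub>K\<^esub> \<psi> z \<otimes>\<^bsub>K\<^esub> \<psi> b" if "z \<in> carrier G" for z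
    using \<psi> carr that by (simp add: hom_mult)
  have "(\<psi> a \<otimes>\<^bsub>K\<^esub> \<psi> x, \<psi> a \<otimes>\<^bsub>K\<^esub> \<psi> y) \<in> r"
    using r le c by (simp add: bi_invariant_total_order_def)
  then have "(\<psi> a \<otimes>\<^bsub>K\<^esub> \<psi> x \<otimes>\<^bsub>K\<^esub> \<psi> b, \<psi> a \<otimes>\<^bsub>K\<^esub> \<psi> y \<otimes>\<^bsub>K\<^esub> \<psi> b) \<in> r"
    using r c by (simp add: bi_invariant_total_order_def)
  moreover have "trans r"
    using r by (simp add: bi_invariant_total_order_def order_on_defs)
  ultimately show ?thesis
    using cut carr by (metis m transD)
qed

section \<open>The false confidence bound\<close>

theorem theorem2:
  fixes G :: "('x \<Rightarrow> 'x) monoid"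
    and T :: "('x \<Rightarrow> 'x) topology"
    and \<nu> :: "'x measure"
    and p :: "('x \<Rightarrow> 'x) \<Rightarrow> 'x \<Rightarrow> real"
    and mlt :: "('x \<Rightarrow> 'x) \<Rightarrow> real"
    and lam \<rho> :: "('x \<Rightarrow> 'x) measure"
    and \<mu> :: "'u measure"
    and t :: "'x \<Rightarrow> ('x \<Rightarrow> 'x) \<times> 'u"
    and f :: "('x \<Rightarrow> 'x) \<times> 'u \<Rightarrow> real"
    and \<kappa> :: "'u \<Rightarrow> ('x \<Rightarrow> 'x) measure"
    and K :: "'k monoid"
    and r :: "'k rel"
    and \<psi> :: "('x \<Rightarrow> 'x) \<Rightarrow> 'k"
    and k :: 'k
    and A :: "('x \<Rightarrow> 'x) set"
  assumes "invariant_model G T \<nu> p mlt lam \<rho> \<mu> t"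
    and "pivotal_density G \<nu> p lam \<mu> t f"
    and "pivot_cond_dist G \<nu> p lam \<mu> t f \<kappa>"
    and "group K"
    and "bi_invariant_total_order K r"
    and "\<psi> \<in> hom G K"
    and "k \<in> carrier K"
    and "A = {\<theta>\<in>carrier G. (\<psi> \<theta>, k) \<in> r}"
    and "A \<in> sets (borel_of T)"
  shows "no_false_confidence (model_dist \<nu> p) (fiducial G t \<kappa>) A"
  unfolding no_false_confidence_def
proof (intro ballI SUP_least)
  fix \<alpha> :: real and \<theta> :: "'x \<Rightarrow> 'x"
  assume "\<alpha> \<in> {0..1}" and \<theta>A: "\<theta> \<in> A"
  interpret im: invariant_model G T \<nu> p mlt lam \<rho> \<mu> t by fact
  interpret H: sigma_finite_haar_group G T lam
    using im.left_haar
    by (intro sigma_finite_haar_group.intro sigma_finite_radon_space.intro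
        sigma_finite_haar_group_axioms.intro im.topological_group_axioms im.locally_compact im.sigma_finite)
      (simp_all add: left_haar_measure_def)
  note A_def = assms(8)
  have \<theta>: "\<theta> \<in> carrier G" using \<theta>A A_def by simp
  define P where "P = model_dist \<nu> p \<theta>"
  interpret P: prob_space P unfolding P_def using \<theta> by (rule im.densities)
  have spP: "space P = space \<nu>" and seP: "sets P = sets \<nu>"
    by (simp_all add: P_def model_dist_def)
  have tm: "t \<in> measurable P (lam \<Otimes>\<^sub>M \<mu>)"
    using im.t_measurable by (simp cong: measurable_cong_sets add: seP)
  define HU where "HU x = (inv\<^bsub>G\<^esub> \<theta> \<otimes>\<^bsub>G\<^esub> fst (t x), snd (t x))" for x
  have "(\<lambda>h. inv\<^bsub>G\<^esub> \<theta> \<otimes>\<^bsub>G\<^esub> h) \<in> measurable lam lam"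
    using \<theta> by (intro H.continuous_map_measurable im.continuous_map_mult im.continuous_map_group_const) simp_all
  then have HUm: "HU \<in> measurable P (lam \<Otimes>\<^sub>M \<mu>)"
    unfolding HU_def using tm by measurable
  define PU where "PU = distr P \<mu> (\<lambda>x. snd (t x))"
  have sndm: "(\<lambda>x. snd (t x)) \<in> measurable P \<mu>" using tm by measurable
  have PU: "prob_space PU" unfolding PU_def using sndm by (rule P.prob_space_distr)
  have sePU: "sets PU = sets \<mu>" by (simp add: PU_def)
  define M where "M = distr P (lam \<Otimes>\<^sub>M \<mu>) HU"
  have M: "prob_space M" unfolding M_def using HUm by (rule P.prob_space_distr)
  have \<kappa>: "\<kappa> \<in> measurable \<mu> (prob_algebra lam)"
    using assms(3) by (simp add: pivot_cond_dist_def)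
  note \<kappa>_\<theta> = bspec[OF conjunct2[OF assms(3)[unfolded pivot_cond_dist_def Let_def]] \<theta>,
      folded P_def, folded PU_def]
  have cond: "emeasure P {x\<in>space \<nu>. inv\<^bsub>G\<^esub> \<theta> \<otimes>\<^bsub>G\<^esub> fst (t x) \<in> B \<and> snd (t x) \<in> D} =
                (\<integral>\<^sup>+u\<in>D. emeasure (\<kappa> u) B \<partial>PU)" if "B \<in> sets lam" "D \<in> sets \<mu>" for B D
    using conjunct1[OF \<kappa>_\<theta>] that by blast
  have dens: "AE u in PU. \<exists>c::real. \<kappa> u = density lam (\<lambda>h. ennreal c * ennreal (f (h, u)))"
    by (rule conjunct2[OF \<kappa>_\<theta>])
  have fm: "f \<in> borel_measurable (lam \<Otimes>\<^sub>M \<mu>)"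
    using assms(2) by (simp add: pivotal_density_def)
  have rect: "emeasure M (B \<times> D) = (\<integral>\<^sup>+u\<in>D. emeasure (\<kappa> u) B \<partial>PU)" if "B \<in> sets lam" "D \<in> sets \<mu>" for B D
  proof -
    have "HU -` (B \<times> D) \<inter> space P = {x\<in>space \<nu>. inv\<^bsub>G\<^esub> \<theta> \<otimes>\<^bsub>G\<^esub> fst (t x) \<in> B \<and> snd (t x) \<in> D}"
      by (auto simp: HU_def spP)
    then show ?thesis
      unfolding M_def using HUm that by (simp add: emeasure_distr cond)
  qed
  define E where "E = {h \<in> carrier G. \<theta> \<otimes>\<^bsub>G\<^esub> inv\<^bsub>G\<^esub> h \<in> A}"
  define B where "B x = {h \<in> carrier G. \<theta> \<otimes>\<^bsub>G\<^esub> x \<otimes>\<^bsub>G\<^esub> inv\<^bsub>G\<^esub> h \<in> A}" for x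
  have Am: "A \<in> sets lam" using assms(9) by (simp add: H.sets_M)
  have Em: "E \<in> sets lam"
    unfolding E_def using \<theta> Am
    by (intro H.preimage_sets im.continuous_map_mult im.continuous_map_group_const im.continuous_inv)
  have Bm: "B x \<in> sets lam" if "x \<in> carrier G" for x
    unfolding B_def using \<theta> Am that
    by (intro H.preimage_sets im.continuous_map_mult im.continuous_map_group_const im.continuous_inv) auto
  have BE: "h \<in> B x \<longleftrightarrow> h \<otimes>\<^bsub>G\<^esub> inv\<^bsub>G\<^esub> x \<in> E" if "x \<in> carrier G" "h \<in> carrier G" for x h
    using that \<theta> by (simp add: B_def E_def im.inv_mult_group im.m_assoc)
  \<comment> \<open>\<open>B_anti\<close>, \<open>B_refl\<close> and \<open>total\<close> are all that is used of the order.\<close>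
  have B_anti: "B y \<subseteq> B x" if "x \<in> carrier G" "y \<in> carrier G" "(\<psi> x, \<psi> y) \<in> r" for x y
  proof
    fix h assume "h \<in> B y"
    then have h: "h \<in> carrier G" "(\<psi> (\<theta> \<otimes>\<^bsub>G\<^esub> y \<otimes>\<^bsub>G\<^esub> inv\<^bsub>G\<^esub> h), k) \<in> r"
      by (auto simp: B_def A_def)
    have "(\<psi> (\<theta> \<otimes>\<^bsub>G\<^esub> x \<otimes>\<^bsub>G\<^esub> inv\<^bsub>G\<^esub> h), k) \<in> r"
      by (rule ordered_hom_cut_mono[where K = K and y = y])
        (use im.is_group assms(4-7) \<theta> that h in auto)
    then show "h \<in> B x"
      using \<theta> that(1) h(1) by (simp add: B_def A_def)
  qed
  have B_refl: "x \<in> B x" if "x \<in> carrier G" for x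
    using \<theta>A that \<theta> by (simp add: B_def im.m_assoc)
  have total: "(\<psi> x, \<psi> y) \<in> r \<or> (\<psi> y, \<psi> x) \<in> r" if "x \<in> carrier G" "y \<in> carrier G" for x y
  proof -
    have "\<psi> x \<in> carrier K" "\<psi> y \<in> carrier K" using assms(6) that by (auto simp: hom_def)
    moreover have "total_on (carrier K) r" "refl_on (carrier K) r"
      using assms(5) by (auto simp: bi_invariant_total_order_def order_on_defs)
    ultimately show ?thesis by (metis refl_onD total_on_def)
  qed
  have B_dich: "(y \<in> B x \<and> B y \<subseteq> B x) \<or> (x \<in> B y \<and> B x \<subseteq> B y)"
    if "x \<in> carrier G" "y \<in> carrier G" for x y
    using total[OF that] B_anti B_refl that by blast
  obtain X R where X: "X \<in> sets lam" "AE x in lam. x \<in> X" and R: "R \<in> sets (lam \<Otimes>\<^sub>M lam)"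
    and R1: "\<forall>x\<in>X. AE y in lam. (x, y) \<in> R \<longleftrightarrow> y \<otimes>\<^bsub>G\<^esub> inv\<^bsub>G\<^esub> x \<in> E"
    and R2: "\<forall>x\<in>X. AE y in lam. x \<otimes>\<^bsub>G\<^esub> inv\<^bsub>G\<^esub> y \<in> E \<longrightarrow> (y, x) \<in> R"
    using H.division_relation_modification[OF Em] .
  have XG: "X \<subseteq> carrier G"
    using sets.sets_into_space[OF X(1)] by (simp add: H.space_eq_carrier)
  \<comment> \<open>The labels \<open>u\<close> for which \<open>\<kappa> u\<close> has a density, so that Haar null sets are \<open>\<kappa> u\<close>-null.\<close>
  define good where "good u \<longleftrightarrow> u \<in> space \<mu> \<and> (\<exists>c::real. \<kappa> u = density lam (\<lambda>h. ennreal c * ennreal (f (h, u))))" for u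
  have good_AE: "AE u in PU. good u"
    using dens AE_space by eventually_elim (simp add: good_def PU_def)
  have ac: "AE h in \<kappa> u. Q h" if "good u" "AE h in lam. Q h" for u Q
  proof -
    obtain c :: real where c: "\<kappa> u = density lam (\<lambda>h. ennreal c * ennreal (f (h, u)))" and u: "u \<in> space \<mu>"
      using \<open>good u\<close> by (auto simp: good_def)
    have "(\<lambda>h. ennreal c * ennreal (f (h, u))) \<in> borel_measurable lam"
      using fm u by measurable
    then show ?thesis
      unfolding c using that(2) by (subst AE_density) (auto elim: eventually_mono)
  qed
  have \<kappa>u: "prob_space (\<kappa> u)" "sets (\<kappa> u) = sets lam" "space (\<kappa> u) = space lam" if "good u" for u
    using measurable_space[OF \<kappa>, of u] that
    by (auto simp: good_def space_prob_algebra dest: sets_eq_imp_space_eq)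
  have sec: "emeasure (\<kappa> u) (Pair x -` R) = emeasure (\<kappa> u) (B x)" if u: "good u" and x: "x \<in> X" for u x
  proof (rule emeasure_eq_AE)
    show "AE y in \<kappa> u. y \<in> Pair x -` R \<longleftrightarrow> y \<in> B x"
      using ac[OF u R1[rule_format, OF x]] AE_space
      by eventually_elim (use x XG BE in \<open>auto simp: \<kappa>u[OF u] H.space_eq_carrier\<close>)
  qed (use R x XG Bm in \<open>auto simp: \<kappa>u[OF u] intro: sets_Pair1\<close>)
  \<comment> \<open>Formulated with \<open>R\<close> instead of \<open>B\<close>, the bad event is jointly measurable in pivot and label.\<close>
  define Y where "Y = {(h, u). h \<in> X \<and> u \<in> space \<mu> \<and> emeasure (\<kappa> u) (Pair h -` R) \<le> ennreal \<alpha>}"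
  have Ym: "Y \<in> sets (lam \<Otimes>\<^sub>M \<mu>)"
    unfolding Y_def by (rule kernel_section_sublevel_measurable[OF \<kappa> X(1) R])
  have "emeasure (\<kappa> u) ((\<lambda>h. (h, u)) -` Y) \<le> ennreal \<alpha>" if u: "good u" for u
  proof -
    interpret ku: prob_space "\<kappa> u" by (rule \<kappa>u[OF u])
    have "(\<lambda>h. (h, u)) -` Y = {x \<in> X. emeasure (\<kappa> u) (B x) \<le> ennreal \<alpha>}"
      using u sec[OF u] by (auto simp: Y_def good_def)
    also have "emeasure (\<kappa> u) \<dots> \<le> ennreal \<alpha>"
    proof (rule ku.emeasure_chain_sublevel_le)
      show "R \<in> sets (\<kappa> u \<Otimes>\<^sub>M \<kappa> u)" using R by (simp cong: sets_pair_measure_cong add: \<kappa>u[OF u])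
      show "X \<in> sets (\<kappa> u)" using X by (simp add: \<kappa>u[OF u])
      show "B x \<in> sets (\<kappa> u)" if "x \<in> X" for x using Bm XG that by (auto simp: \<kappa>u[OF u])
      show "AE y in \<kappa> u. (x, y) \<in> R \<longleftrightarrow> y \<in> B x" if x: "x \<in> X" for x
        using ac[OF u R1[rule_format, OF x]] AE_space
        by eventually_elim (use x XG BE in \<open>auto simp: \<kappa>u[OF u] H.space_eq_carrier\<close>)
      show "AE y in \<kappa> u. (x, y) \<in> R \<or> (y, x) \<in> R" if x: "x \<in> X" for x
        using ac[OF u R1[rule_format, OF x]] ac[OF u R2[rule_format, OF x]] AE_space
      proof eventually_elim
        case (elim y)
        then have "x \<in> carrier G" "y \<in> carrier G" 
          using x XG by (auto simp: \<kappa>u[OF u] H.space_eq_carrier)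
        with elim show ?case using B_dich[of x y] BE[of x y] BE[of y x] by blast
      qed
      show "B x \<subseteq> B y \<or> B y \<subseteq> B x" if "x \<in> X" "y \<in> X" for x y
        using B_dich[of x y] XG that by blast
      show "B x \<subseteq> B y" if "x \<in> X" "y \<in> X" "y \<notin> B x" for x y
        using B_dich[of x y] XG that by blast
    qed
    finally show ?thesis .
  qed
  then have "AE u in PU. emeasure (\<kappa> u) ((\<lambda>h. (h, u)) -` Y) \<le> ennreal \<alpha>"
    using good_AE by (auto elim: eventually_mono)
  then have MY: "emeasure M Y \<le> ennreal \<alpha>"
    using Ym rect M PU \<kappa> sePU by (intro emeasure_le_if_sections_le[of \<kappa> \<mu> lam PU M Y]) (auto simp: M_def)
  \<comment> \<open>Outside a null set the original event lies in the measurable event given by \<open>Y\<close>; this bounds its outer measure.\<close>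
  have "AE x in P. fst (HU x) \<in> X"
  proof -
    have Xc: "space lam - X \<in> sets lam" using X(1) by auto
    have "AE u in PU. emeasure (\<kappa> u) (space lam - X) = 0"
      using good_AE
    proof eventually_elim
      case (elim u)
      have "AE h in \<kappa> u. h \<notin> space lam - X"
        using ac[OF elim X(2)] by eventually_elim blast
      then show ?case
        using Xc by (simp add: AE_iff_null_sets \<kappa>u[OF elim] null_setsD1)
    qed
    then have "(\<integral>\<^sup>+u\<in>space \<mu>. emeasure (\<kappa> u) (space lam - X) \<partial>PU) = (\<integral>\<^sup>+u. 0 \<partial>PU)"
      by (intro nn_integral_cong_AE) (auto elim: eventually_mono)
    then have "emeasure M ((space lam - X) \<times> space \<mu>) = 0"
      using rect[OF Xc sets.top] by simp
    then have "(space lam - X) \<times> space \<mu> \<in> null_sets M"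
      using Xc by (intro null_setsI) (auto simp: M_def)
    then have "AE z in M. z \<notin> (space lam - X) \<times> space \<mu>" by (rule AE_not_in)
    then have "AE x in P. HU x \<notin> (space lam - X) \<times> space \<mu>"
      unfolding M_def by (rule AE_distrD[OF HUm])
    then show ?thesis
      using AE_space
    proof eventually_elim
      case (elim x)
      then show ?case using measurable_space[OF HUm elim(2)] by (cases "HU x") (auto simp: space_pair_measure)
    qed
  qed
  moreover have "AE x in P. good (snd (t x))"
    using good_AE unfolding PU_def by (rule AE_distrD[OF sndm])
  ultimately have "AE x in P. fiducial G t \<kappa> x A \<le> \<alpha> \<longrightarrow> HU x \<in> Y"
    using AE_space
  proof eventually_elim
    case (elim x)
    let ?h = "fst (HU x)" and ?u = "snd (t x)"
    interpret ku: prob_space "\<kappa> ?u" by (rule \<kappa>u[OF elim(2)])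
    have g: "fst (t x) \<in> carrier G"
      using measurable_space[OF tm elim(3)] by (auto simp: space_pair_measure H.space_eq_carrier)
    have "\<theta> \<otimes>\<^bsub>G\<^esub> ?h = fst (t x)"
      using \<theta> g by (simp add: HU_def im.m_assoc[symmetric])
    then have "fiducial G t \<kappa> x A = measure (\<kappa> ?u) (B ?h)"
      by (simp add: fiducial_def B_def case_prod_beta')
    then have "emeasure (\<kappa> ?u) (Pair ?h -` R) \<le> ennreal \<alpha>" if "fiducial G t \<kappa> x A \<le> \<alpha>"
      using that sec[OF elim(2,1)] by (simp add: ku.emeasure_eq_measure ennreal_leI)
    then show ?case
      using elim by (auto simp: Y_def HU_def good_def)
  qed
  then obtain N where N: "N \<in> null_sets P"
      and bad: "{x \<in> space P. \<not> (fiducial G t \<kappa> x A \<le> \<alpha> \<longrightarrow> HU x \<in> Y)} \<subseteq> N"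
    unfolding eventually_ae_filter by blast
  have Vm: "HU -` Y \<inter> space P \<in> sets P"
    using HUm Ym by (rule measurable_sets)
  have "outer_measure_of P {x \<in> space P. fiducial G t \<kappa> x A \<le> \<alpha>} \<le> outer_measure_of P ((HU -` Y \<inter> space P) \<union> N)"
    using bad by (intro outer_measure_of_mono) blast
  also have "\<dots> = emeasure P ((HU -` Y \<inter> space P) \<union> N)"
    using Vm N by (intro outer_measure_of_eq) auto
  also have "\<dots> = emeasure P (HU -` Y \<inter> space P)"
    using Vm N by (rule emeasure_Un_null_set)
  also have "\<dots> = emeasure M Y"
    unfolding M_def using HUm Ym by (simp add: emeasure_distr)
  also have "\<dots> \<le> ennreal \<alpha>" by (rule MY)
  finally show "outer_measure_of (model_dist \<nu> p \<theta>) {x \<in> space (model_dist \<nu> p \<theta>). fiducial G t \<kappa> x A \<le> \<alpha>} \<le> ennreal \<alpha>"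
    by (simp only: P_def)
qed

end
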